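(* For every integer $d\ge 1$, the cone $$\mathcal{C}^d=\left\{(\xi_1,\dots,\xi_d,\xi_{d+1})\in\mathbb{R}^{d+1}: |(\xi_1,\dots,\xi_d)|=|\xi_{d+1}|\right\}$$ in $\mathbb{R}^{d+1}$ has Fourier dimension $d-1$.
   Context: $|\cdot|$ is the Euclidean norm. For a Borel measure $\mu$ on $\mathbb{R}^n$, $\hat\mu(\xi)=\int_{\mathbb{R}^n} e^{-2\pi i\xi\cdot x}\,d\mu(x)$. The Fourier dimension of a closed set $E\subseteq\mathbb{R}^n$ is the supremum of those $s\in[0,n]$ for which there exist a Borel probability measure $\mu$ supported on $E$ and a constant $C>0$ with $|\hat\mu(\xi)|\le C|\xi|^{-s/2}$ for all $\xi\in\mathbb{R}^n\setminus\{0\}$. Here this is applied with $n=d+1$. *)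

theory Defs
  imports "HOL-Probability.Probability"
begin

definition fourier_measure :: "'a::euclidean_space measure \<Rightarrow> 'a \<Rightarrow> complex" where
  "fourier_measure \<mu> \<xi> = (\<integral>x. exp (- 2 * of_real pi * \<i> * of_real (\<xi> \<bullet> x)) \<partial>\<mu>)"

text \<open>
  For closed \<open>E\<close>, the condition \<open>AE x in \<mu>. x \<in> E\<close> says that \<open>\<mu>\<close> gives mass 0 to the open
  complement of \<open>E\<close>, i.e. that the support of \<open>\<mu>\<close> is contained in \<open>E\<close>.
\<close>
definition fourier_decay :: "'a::euclidean_space set \<Rightarrow> real \<Rightarrow> bool" where
  "fourier_decay E s \<longleftrightarrow>
     (\<exists>\<mu>. sets \<mu> = sets borel \<and> prob_space \<mu> \<and> (AE x in \<mu>. x \<in> E) \<and>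
        (\<exists>C>0. \<forall>\<xi>. \<xi> \<noteq> 0 \<longrightarrow> cmod (fourier_measure \<mu> \<xi>) \<le> C * norm \<xi> powr (- s / 2)))"

text \<open>
  Meant for closed \<open>E\<close>. If \<open>E\<close> is nonempty, then the set below contains \<open>0\<close> (take a point mass)
  and is bounded, so the real-valued \<open>Sup\<close> is a genuine supremum; for \<open>E = {}\<close> it is
  unspecified.
\<close>
definition fourier_dimension :: "'a::euclidean_space set \<Rightarrow> real" where
  "fourier_dimension E = Sup {s. 0 \<le> s \<and> s \<le> real DIM('a) \<and> fourier_decay E s}"

text \<open>
  The space \<open>\<real>\<^sup>d\<^sup>+\<^sup>1\<close> is rendered as \<open>(real ^ 'd) \<times> real\<close> with \<open>d = CARD('d)\<close>: the first component
  collects the first \<open>d\<close> coordinates, the second is the last one. The library's norm and inner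
  product on this product type are the Euclidean ones.
\<close>
definition light_cone :: "((real ^ 'd) \<times> real) set" where
  "light_cone = {(x, t). norm x = \<bar>t\<bar>}"

end

theory Submission
  imports Defs
begin

text \<open>
  Write \<open>d\<close> for the dimension of the space of the \<open>\<xi>\<close> and consider
  \<open>A (x, t) = \<integral> exp (- norm \<xi> - \<i> * (x \<bullet> \<xi> + t * norm \<xi>)) d\<xi>\<close>, the Fourier transform of the
  push-forward of \<open>exp (- norm \<xi>) d\<xi>\<close> to the cone by \<open>\<xi> \<mapsto> (\<xi>, norm \<xi>)\<close>. It is the Poisson kernel
  at the complex height \<open>z = 1 + \<i> * t\<close>: up to a constant, \<open>A (x, t) = z * D powr (- (d + 1) / 2)\<close> with
  \<open>D = z\<^sup>2 + (norm x)\<^sup>2\<close> (lemma \<open>integral_wave\<close>). This one formula gives both bounds.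

  Lower bound. Since \<open>norm D\<close> dominates \<open>norm z\<close> and \<open>norm (x, t)\<close>, the formula yields
  \<open>norm (A (x, t)) \<le> const * norm (x, t) powr (- (d - 1) / 2)\<close>. So the normalised push-forward is a
  probability measure on the cone with decay exponent \<open>d - 1\<close> (lemma \<open>fourier_decay_cone\<close>).

  Upper bound. Let \<open>\<mu>\<close> live on the cone and have decay exponent \<open>s > d - 1\<close>. Average its transform at
  the frequencies \<open>k * (\<xi>, norm \<xi>)\<close> against \<open>exp (- norm \<xi>)\<close>. The decay makes this
  \<open>o (k powr (- (d - 1) / 2))\<close>. By Fubini it is also the integral of \<open>A (k * x, k * t)\<close> with respect to
  \<open>\<mu>\<close>; on the cone \<open>D = 1 + 2 * \<i> * k * t\<close>, so \<open>k powr ((d - 1) / 2) * A (k * x, k * t)\<close> converges to a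
  nonzero multiple of \<open>\<bar>t\<bar> powr (- (d - 1) / 2)\<close>, with conjugate phases for \<open>t > 0\<close> and \<open>t < 0\<close>. Two
  obstacles remain, the singularity at the vertex and the possible cancellation between the two
  halves of the cone. Both disappear if \<open>\<mu>\<close> is first multiplied by a suitable power of the odd
  function \<open>t / (1 + t\<^sup>2)\<close>: this preserves the decay (lemma \<open>weighted_transform_decay\<close>), removes the
  singularity, and for a suitable parity of the exponent aligns the signs (lemma \<open>cone_limit_sign\<close>).
  The conclusion is that \<open>\<mu>\<close> gives no mass to \<open>t \<noteq> 0\<close>, hence is a point mass at the vertex, which
  has no decay at all (lemma \<open>fourier_decay_cone_le\<close>).
\<close>

section \<open>Radial integrability and differentiation under the integral\<close>

text \<open>
  The radial integral is reduced to Euler's Gamma integral without polar coordinates: up to a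
  constant, the integrand at \<open>x\<close> is at most the integral of \<open>u powr (-q-1) * exp (-a*u/2)\<close> over
  \<open>norm x \<le> u \<le> 2 * norm x\<close>, and after exchanging the integrals the points \<open>x\<close> that see a
  given \<open>u\<close> lie in a ball of volume proportional to \<open>u ^ DIM('a)\<close>.
\<close>
lemma integrable_norm_powr_exp:
  fixes q a :: real
  assumes q: "q < real DIM('a::euclidean_space)" and a: "a > 0"
  shows "integrable lborel (\<lambda>x::'a. norm x powr (-q) * exp (- a * norm x))"
proof (rule integrableI_bounded)
  let ?d = "DIM('a)"
  define h where "h u = u powr (-q-1) * exp (- (a/2) * u)" for u :: real
  \<comment> \<open>\<open>c\<close> absorbs the change of \<open>u powr (-q-1)\<close> over a factor of 2, whatever the sign of the exponent.\<close>
  define c where "c = max 1 (2 powr (q+1))"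
  define V where "V = unit_ball_vol (real ?d)"
  have c: "c > 0" by (simp add: c_def)
  have V: "V \<ge> 0" by (simp add: V_def)
  have [measurable]: "h \<in> borel_measurable borel" unfolding h_def by measurable
  have h0: "h u \<ge> 0" for u by (simp add: h_def)
  have pt: "ennreal (norm (norm x powr (-q) * exp (- a * norm x))) \<le>
      ennreal c * (\<integral>\<^sup>+u. ennreal (h u) * indicator {(x::'a,u). norm x \<le> u \<and> u \<le> 2 * norm x} (x,u) \<partial>lborel)"
    if "x \<noteq> 0" for x :: 'a
  proof -
    let ?n = "norm x"
    have n: "?n > 0" using that by simp
    have low: "h u \<ge> ?n powr (-q-1) * exp (- a * ?n) / c" if u: "?n \<le> u" "u \<le> 2 * ?n" for u
    proof -
      have "?n powr (-q-1) \<le> c * u powr (-q-1)"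
      proof (cases "-q-1 \<ge> 0")
        case True
        then have "?n powr (-q-1) \<le> u powr (-q-1)" using u n by (intro powr_mono2) auto
        also have "\<dots> \<le> c * u powr (-q-1)"
          using mult_right_mono[of 1 c "u powr (-q-1)"] by (simp add: c_def)
        finally show ?thesis .
      next
        case False
        have "u > 0" using u n by linarith
        with False have "(2 * ?n) powr (-q-1) \<le> u powr (-q-1)" using u by (intro powr_mono2') auto
        then have "2 powr (-q-1) * ?n powr (-q-1) \<le> u powr (-q-1)"
          using n by (simp add: powr_mult)
        then have "2 powr (q+1) * (2 powr (-q-1) * ?n powr (-q-1)) \<le> 2 powr (q+1) * u powr (-q-1)"
          by (intro mult_left_mono) auto
        moreover have "2 powr (q+1) * 2 powr (-q-1) = (1::real)" by (simp flip: powr_add)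
        ultimately have "?n powr (-q-1) \<le> 2 powr (q+1) * u powr (-q-1)"
          by (simp flip: mult.assoc)
        also have "\<dots> \<le> c * u powr (-q-1)" by (intro mult_right_mono) (auto simp: c_def)
        finally show ?thesis .
      qed
      moreover have "exp (- a * ?n) \<le> exp (- (a/2) * u)" using u a by (simp)
      ultimately have "?n powr (-q-1) * exp (- a * ?n) \<le> (c * u powr (-q-1)) * exp (- (a/2) * u)"
        by (intro mult_mono) (use c in auto)
      then show ?thesis using c by (simp add: h_def field_simps)
    qed
    have "ennreal (?n powr (-q) * exp (- a * ?n) / c)
       = ennreal (?n powr (-q-1) * exp (- a * ?n) / c) * ennreal ?n"
      using n c by (subst ennreal_mult[symmetric]) (auto simp: powr_diff powr_minus field_simps)
    also have "\<dots> = (\<integral>\<^sup>+u. ennreal (?n powr (-q-1) * exp (- a * ?n) / c) * indicator {?n..2*?n} u \<partial>lborel)"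
      by (subst nn_integral_cmult_indicator) auto
    also have "\<dots> \<le> (\<integral>\<^sup>+u. ennreal (h u) * indicator {(x::'a,u). norm x \<le> u \<and> u \<le> 2 * norm x} (x,u) \<partial>lborel)"
      using low by (intro nn_integral_mono) (auto simp: indicator_def intro!: ennreal_leI)
    finally have "ennreal c * ennreal (?n powr (-q) * exp (- a * ?n) / c) \<le> ennreal c * \<dots>"
      by (rule mult_left_mono) auto
    moreover have "ennreal c * ennreal (?n powr (-q) * exp (- a * ?n) / c) = ennreal (?n powr (-q) * exp (- a * ?n))"
      using c by (subst ennreal_mult[symmetric]) auto
    ultimately show ?thesis by simp
  qed
  have "(\<integral>\<^sup>+(x::'a). ennreal (norm (norm x powr (-q) * exp (- a * norm x))) \<partial>lborel)
     \<le> (\<integral>\<^sup>+(x::'a). ennreal c * (\<integral>\<^sup>+u. ennreal (h u) * indicator {(x::'a,u). norm x \<le> u \<and> u \<le> 2 * norm x} (x,u) \<partial>lborel) \<partial>lborel)"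
  proof (rule nn_integral_mono_AE)
    have "AE x in lborel. x \<noteq> (0::'a)" by (rule AE_lborel_singleton)
    then show "AE x::'a in lborel. ennreal (norm (norm x powr (-q) * exp (- a * norm x))) \<le>
      ennreal c * (\<integral>\<^sup>+u. ennreal (h u) * indicator {(x::'a,u). norm x \<le> u \<and> u \<le> 2 * norm x} (x,u) \<partial>lborel)"
      by eventually_elim (rule pt)
  qed
  also have "\<dots> = ennreal c * (\<integral>\<^sup>+u. (\<integral>\<^sup>+(x::'a). ennreal (h u) * indicator {(x::'a,u). norm x \<le> u \<and> u \<le> 2 * norm x} (x,u) \<partial>lborel) \<partial>lborel)"
    by (subst nn_integral_cmult, measurable, subst lborel_pair.Fubini', measurable)
  also have "\<dots> \<le> ennreal c * (\<integral>\<^sup>+u. ennreal (V * (u powr (real ?d - q - 1) * exp (- (a/2) * u) * indicator {0<..} u)) \<partial>lborel)"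
  proof (intro mult_left_mono nn_integral_mono_AE)
    have "AE u in lborel. u \<noteq> (0::real)" by (rule AE_lborel_singleton)
    then show "AE u in lborel. (\<integral>\<^sup>+(x::'a). ennreal (h u) * indicator {(x::'a,u). norm x \<le> u \<and> u \<le> 2 * norm x} (x,u) \<partial>lborel)
       \<le> ennreal (V * (u powr (real ?d - q - 1) * exp (- (a/2) * u) * indicator {0<..} u))"
    proof eventually_elim
      case (elim u)
      show ?case
      proof (cases "u > 0")
        case True
        have "(\<integral>\<^sup>+(x::'a). ennreal (h u) * indicator {(x::'a,u). norm x \<le> u \<and> u \<le> 2 * norm x} (x,u) \<partial>lborel)
           \<le> (\<integral>\<^sup>+(x::'a). ennreal (h u) * indicator (cball 0 u) x \<partial>lborel)"
          by (intro nn_integral_mono mult_left_mono) (auto simp: indicator_def)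
        also have "\<dots> = ennreal (h u) * emeasure lborel (cball (0::'a) u)"
          by (subst nn_integral_cmult_indicator) auto
        also have "\<dots> = ennreal (h u) * ennreal (V * u ^ ?d)"
          using True by (subst emeasure_cball) (auto simp: V_def)
        also have "\<dots> = ennreal (V * (u powr (real ?d - q - 1) * exp (- (a/2) * u)))"
        proof -
          have "u powr (real ?d - q - 1) = u powr (-q-1) * u ^ ?d"
            using True by (simp flip: powr_realpow powr_add add: algebra_simps)
          then show ?thesis
            using h0[of u] V True by (subst ennreal_mult[symmetric]) (auto simp: h_def mult_ac)
        qed
        finally show ?thesis using True by simp
      next
        case False
        then have "(\<integral>\<^sup>+(x::'a). ennreal (h u) * indicator {(x::'a,u). norm x \<le> u \<and> u \<le> 2 * norm x} (x,u) \<partial>lborel) = (\<integral>\<^sup>+(x::'a). 0 \<partial>lborel)"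
          using elim by (intro nn_integral_cong) (auto simp: indicator_def not_less intro: order.antisym dest: order_trans[OF norm_ge_zero])
        then show ?thesis by simp
      qed
    qed
  qed auto
  also have "\<dots> < \<infinity>"
  proof -
    have "(\<lambda>t. complex_of_real t powr (of_real (real ?d - q) - 1) / of_real (exp ((a/2) * t))) absolutely_integrable_on {0<..}"
      using q a by (intro absolutely_integrable_Gamma_integral) auto
    then have "set_integrable lebesgue {0<..} (\<lambda>t. norm (complex_of_real t powr (of_real (real ?d - q) - 1) / of_real (exp ((a/2) * t))))"
      by (rule set_integrable_norm)
    also have "?this \<longleftrightarrow> set_integrable lebesgue {0<..} (\<lambda>t. t powr (real ?d - q - 1) * exp (- (a/2) * t))"
      by (intro set_integrable_cong) (auto simp: norm_divide norm_powr_real_powr exp_minus field_simps)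
    finally have "integrable lborel (\<lambda>t. t powr (real ?d - q - 1) * exp (- (a/2) * t) * indicator {0<..} t)"
      unfolding set_integrable_def by (subst (asm) integrable_completion) (auto simp: mult.commute)
    then have "integrable lborel (\<lambda>u. V * (u powr (real ?d - q - 1) * exp (- (a/2) * u) * indicator {0<..} u))"
      by simp
    then have "(\<integral>\<^sup>+u. ennreal (norm (V * (u powr (real ?d - q - 1) * exp (- (a/2) * u) * indicator {0<..} u))) \<partial>lborel) < \<infinity>"
      unfolding integrable_iff_bounded by blast
    then show ?thesis using V by (simp add: ennreal_mult_less_top)
  qed
  finally show "(\<integral>\<^sup>+(x::'a). ennreal (norm (norm x powr (-q) * exp (- a * norm x))) \<partial>lborel) < \<infinity>" .
qed simp

lemma integrable_norm_power_exp:
  assumes a: "a > 0"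
  shows "integrable lborel (\<lambda>x::'a::euclidean_space. norm x ^ k * exp (- a * norm x))"
proof -
  have "integrable lborel (\<lambda>x::'a. norm x powr (- (- real k)) * exp (- a * norm x))"
    using a DIM_positive[where 'a='a] by (intro integrable_norm_powr_exp) linarith+
  moreover have "AE x::'a in lborel. norm x powr (- (- real k)) * exp (- a * norm x) = norm x ^ k * exp (- a * norm x)"
    using AE_lborel_singleton[of "0::'a"] by eventually_elim (simp add: powr_realpow)
  ultimately show ?thesis
    by (subst integrable_cong_AE[where g="\<lambda>x. norm x powr (- (- real k)) * exp (- a * norm x)"]) (auto elim: eventually_mono)
qed

lemma has_vector_derivative_iff_tendsto:
  fixes F :: "real \<Rightarrow> 'b::real_normed_vector"
  shows "(F has_vector_derivative D) (at a) \<longleftrightarrow> ((\<lambda>h. (F h - F a) /\<^sub>R (h - a)) \<longlongrightarrow> D) (at a)"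
proof -
  have "(F has_vector_derivative D) (at a) \<longleftrightarrow> ((\<lambda>y. norm (F y - F a - (y - a) *\<^sub>R D) / norm (y - a)) \<longlongrightarrow> 0) (at a)"
    by (simp add: has_vector_derivative_def has_derivative_iff_norm bounded_linear_scaleR_left)
  also have "\<dots> \<longleftrightarrow> ((\<lambda>h. norm ((F h - F a) /\<^sub>R (h - a) - D)) \<longlongrightarrow> 0) (at a)"
  proof (rule filterlim_cong[OF refl refl])
    have "norm (F y - F a - (y - a) *\<^sub>R D) / norm (y - a) = norm ((F y - F a) /\<^sub>R (y - a) - D)" if "y \<noteq> a" for y
    proof -
      have "(F y - F a) /\<^sub>R (y - a) - D = (F y - F a - (y - a) *\<^sub>R D) /\<^sub>R (y - a)"
        using that by (simp add: scaleR_diff_right)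
      then show ?thesis by (simp add: divide_inverse mult.commute)
    qed
    then show "\<forall>\<^sub>F x in at a. norm (F x - F a - (x - a) *\<^sub>R D) / norm (x - a) = norm ((F x - F a) /\<^sub>R (x - a) - D)"
      by (auto simp: eventually_at_filter)
  qed
  also have "\<dots> \<longleftrightarrow> ((\<lambda>h. (F h - F a) /\<^sub>R (h - a)) \<longlongrightarrow> D) (at a)"
    by (simp add: tendsto_norm_zero_iff Lim_null[symmetric])
  finally show ?thesis .
qed

lemma has_vector_derivative_integral_dominated:
  fixes f :: "real \<Rightarrow> 'b \<Rightarrow> 'c::{banach, second_countable_topology}"
  assumes \<delta>: "\<delta> > 0"
    and int: "\<And>h. \<bar>h\<bar> \<le> \<delta> \<Longrightarrow> integrable M (f h)"
    and f': "f' \<in> borel_measurable M" and g: "integrable M g"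
    and deriv: "AE x in M. ((\<lambda>h. f h x) has_vector_derivative f' x) (at 0)"
    and bound: "\<And>h x. \<bar>h\<bar> \<le> \<delta> \<Longrightarrow> norm (f h x - f 0 x) \<le> \<bar>h\<bar> * g x"
  shows "((\<lambda>h. \<integral>x. f h x \<partial>M) has_vector_derivative (\<integral>x. f' x \<partial>M)) (at 0)"
  unfolding has_vector_derivative_iff_tendsto tendsto_at_iff_sequentially
proof (intro allI impI)
  fix X :: "nat \<Rightarrow> real" assume X: "\<forall>i. X i \<in> UNIV - {0}" and lim: "X \<longlonglongrightarrow> 0"
  from lim \<delta> have "eventually (\<lambda>n. \<bar>X n\<bar> < \<delta>) sequentially"
    by (auto simp: tendsto_iff dist_real_def)
  then obtain N where N: "\<And>n. n \<ge> N \<Longrightarrow> \<bar>X n\<bar> < \<delta>" by (auto simp: eventually_sequentially)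
  have lim': "(\<lambda>i. X (i + N)) \<longlonglongrightarrow> 0" using lim by (rule LIMSEQ_ignore_initial_segment)
  let ?s = "\<lambda>i x. (f (X (i+N)) x - f 0 x) /\<^sub>R X (i+N)"
  have int0: "integrable M (f 0)" using int[of 0] \<delta> by simp
  have ii: "integrable M (f (X (i+N)))" for i using int N[of "i+N"] by simp
  have "(\<lambda>i. \<integral>x. ?s i x \<partial>M) \<longlonglongrightarrow> (\<integral>x. f' x \<partial>M)"
  proof (rule integral_dominated_convergence[OF f' _ g])
    show "?s i \<in> borel_measurable M" for i using ii int0 by (intro borel_measurable_integrable) auto
    show "AE x in M. (\<lambda>i. ?s i x) \<longlonglongrightarrow> f' x"
      using deriv
    proof eventually_elim
      case (elim x)
      then have *: "((\<lambda>h. (f h x - f 0 x) /\<^sub>R h) \<longlongrightarrow> f' x) (at 0)"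
        by (simp add: has_vector_derivative_iff_tendsto)
      have "((\<lambda>h. (f h x - f 0 x) /\<^sub>R h) \<circ> (\<lambda>i. X (i+N))) \<longlonglongrightarrow> f' x"
        by (rule *[unfolded tendsto_at_iff_sequentially, rule_format]) (use X lim' in auto)
      then show ?case by (simp add: o_def)
    qed
    show "AE x in M. norm (?s i x) \<le> g x" for i
    proof (rule AE_I2)
      fix x
      have "norm (f (X (i+N)) x - f 0 x) \<le> \<bar>X (i+N)\<bar> * g x" using bound N[of "i+N"] by simp
      moreover have "\<bar>X (i+N)\<bar> > 0" using X by simp
      ultimately show "norm (?s i x) \<le> g x" by (simp add: divide_le_eq mult.commute flip: divide_inverse_commute)
    qed
  qed
  moreover have eq: "(\<integral>x. ?s i x \<partial>M) = ((\<integral>x. f (X (i+N)) x \<partial>M) - (\<integral>x. f 0 x \<partial>M)) /\<^sub>R X (i+N)" for i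
    using ii int0 by simp
  ultimately have "(\<lambda>i. ((\<lambda>h. ((\<integral>x. f h x \<partial>M) - (\<integral>x. f 0 x \<partial>M)) /\<^sub>R (h - 0)) \<circ> X) (i + N)) \<longlonglongrightarrow> (\<integral>x. f' x \<partial>M)"
    by (simp only: eq o_def diff_zero)
  then show "((\<lambda>h. ((\<integral>x. f h x \<partial>M) - (\<integral>x. f 0 x \<partial>M)) /\<^sub>R (h - 0)) \<circ> X) \<longlonglongrightarrow> (\<integral>x. f' x \<partial>M)"
    by (rule LIMSEQ_offset)
qed

text \<open>
  The mean value inequality on a half plane; it supplies the Lipschitz bounds that dominate the
  difference quotients of the oscillating integrands below.
\<close>
lemma norm_exp_diff_le:
  fixes a b :: complex
  assumes "Re a \<le> M" "Re b \<le> M"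
  shows "norm (exp a - exp b) \<le> exp M * norm (a - b)"
proof (rule field_differentiable_bound[of "{w. Re w \<le> M}" exp exp])
  show "convex {w. Re w \<le> M}" by (rule convex_halfspace_Re_le)
qed (use assms in \<open>auto intro!: DERIV_subset[OF DERIV_exp]\<close>)

section \<open>Two invariance identities for the light cone integral\<close>

lemma integral_lborel_affine:
  fixes f :: "'a::euclidean_space \<Rightarrow> complex"
  assumes f[measurable]: "f \<in> borel_measurable borel" and c: "c \<noteq> 0"
  shows "(\<integral>x. f x \<partial>lborel) = of_real (\<bar>c\<bar> ^ DIM('a)) * (\<integral>x. f (t + c *\<^sub>R x) \<partial>lborel)"
  by (subst lborel_affine[OF c, of t]) (simp add: integral_density integral_distr scaleR_conv_of_real)

text \<open>
  For \<open>z = 1 + \<i> * t\<close> and \<open>\<beta> = 1\<close> this is \<open>exp (- norm \<xi>)\<close> times the character of frequency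
  \<open>(x, t)\<close> at the point \<open>(\<xi>, norm \<xi>)\<close> of the cone. The scaling parameter \<open>\<beta>\<close> is kept apart from
  \<open>x\<close> because the integral is computed by moving along the ray through \<open>(x, t)\<close>.
\<close>
definition wave :: "complex \<Rightarrow> real \<Rightarrow> 'a::euclidean_space \<Rightarrow> 'a \<Rightarrow> complex" where
  "wave z \<beta> x \<xi> = exp (- (z * of_real (norm \<xi>)) - \<i> * of_real (\<beta> * (\<xi> \<bullet> x)))"

lemma wave_measurable [measurable]: "wave z \<beta> x \<in> borel_measurable borel"
  unfolding wave_def by measurable

lemma norm_wave: "norm (wave z \<beta> x \<xi>) = exp (- Re z * norm \<xi>)"
  by (simp add: wave_def norm_exp_eq_Re)

lemma integrable_mult_wave:
  fixes m :: "'a::euclidean_space \<Rightarrow> complex"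
  assumes [measurable]: "m \<in> borel_measurable borel" and m: "\<And>\<xi>. norm (m \<xi>) \<le> K * norm \<xi> ^ k" and z: "Re z > 0"
  shows "integrable lborel (\<lambda>\<xi>. m \<xi> * wave z \<beta> x \<xi>)"
proof (rule Bochner_Integration.integrable_bound)
  show "integrable lborel (\<lambda>\<xi>::'a. K * (norm \<xi> ^ k * exp (- Re z * norm \<xi>)))"
    using integrable_norm_power_exp[OF z] by (rule integrable_mult_right)
  show "AE \<xi> in lborel. norm (m \<xi> * wave z \<beta> x \<xi>) \<le> norm (K * (norm \<xi> ^ k * exp (- Re z * norm \<xi>)))"
  proof (rule AE_I2)
    fix \<xi> :: 'a
    have "norm (m \<xi> * wave z \<beta> x \<xi>) \<le> (K * norm \<xi> ^ k) * exp (- Re z * norm \<xi>)"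
      unfolding norm_mult norm_wave by (intro mult_right_mono m) auto
    then show "norm (m \<xi> * wave z \<beta> x \<xi>) \<le> norm (K * (norm \<xi> ^ k * exp (- Re z * norm \<xi>)))"
      by (simp add: mult.assoc)
  qed
qed measurable

lemma integrable_wave: "Re z > 0 \<Longrightarrow> integrable lborel (wave z \<beta> x)"
  using integrable_mult_wave[of "\<lambda>_. 1" 1 0 z \<beta> x] by simp

text \<open>
  One directional derivative in \<open>(z, \<beta>)\<close> serves two purposes: the direction \<open>(z, \<beta>)\<close> itself gives
  the scaling identity, the direction of a ray through the origin of frequency space gives the
  differential equation.
\<close>
lemma integral_wave_has_derivative:
  fixes x :: "'a::euclidean_space"
  assumes z: "Re z = 1" and z': "\<bar>Re z'\<bar> \<le> 1"
  shows "((\<lambda>h. \<integral>\<xi>. wave (z + of_real h * z') (\<beta> + h * \<beta>') x \<xi> \<partial>lborel) has_vector_derivative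
    (\<integral>\<xi>. - (z' * of_real (norm \<xi>) + \<i> * of_real (\<beta>' * (\<xi> \<bullet> x))) * wave z \<beta> x \<xi> \<partial>lborel)) (at 0)"
proof (rule has_vector_derivative_integral_dominated[where \<delta>="1/2" and g="\<lambda>\<xi>. (norm z' + \<bar>\<beta>'\<bar> * norm x) * (norm \<xi> ^ 1 * exp (- (1/2) * norm \<xi>))"])
  have Re: "Re (z + of_real h * z') \<ge> 1/2" if "\<bar>h\<bar> \<le> 1/2" for h
  proof -
    have "\<bar>h\<bar> * \<bar>Re z'\<bar> \<le> 1/2 * 1" using that z' by (intro mult_mono) auto
    then show ?thesis using z by (simp flip: abs_mult)
  qed
  then show "integrable lborel (wave (z + of_real h * z') (\<beta> + h * \<beta>') x)" if "\<bar>h\<bar> \<le> 1/2" for h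
    using Re[OF that] by (intro integrable_wave) auto
  show "integrable lborel (\<lambda>\<xi>::'a. (norm z' + \<bar>\<beta>'\<bar> * norm x) * (norm \<xi> ^ 1 * exp (- (1/2) * norm \<xi>)))"
    by (intro integrable_mult_right integrable_norm_power_exp) auto
  have expand: "wave (z + of_real h * z') (\<beta> + h * \<beta>') x \<xi> =
     exp (- (z * of_real (norm \<xi>)) - \<i> * of_real (\<beta> * (\<xi> \<bullet> x)) + of_real h * (- (z' * of_real (norm \<xi>) + \<i> * of_real (\<beta>' * (\<xi> \<bullet> x)))))" for h \<xi>
    by (simp add: wave_def algebra_simps)
  show "AE \<xi> in lborel. ((\<lambda>h. wave (z + of_real h * z') (\<beta> + h * \<beta>') x \<xi>) has_vector_derivative
      - (z' * of_real (norm \<xi>) + \<i> * of_real (\<beta>' * (\<xi> \<bullet> x))) * wave z \<beta> x \<xi>) (at 0)"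
  proof (rule AE_I2)
    fix \<xi> :: 'a
    let ?a = "- (z * of_real (norm \<xi>)) - \<i> * of_real (\<beta> * (\<xi> \<bullet> x))"
      and ?b = "- (z' * of_real (norm \<xi>) + \<i> * of_real (\<beta>' * (\<xi> \<bullet> x)))"
    have "((\<lambda>h. ?a + of_real h * ?b) has_vector_derivative ?b) (at 0)"
      by (auto intro!: derivative_eq_intros simp: has_vector_derivative_def fun_eq_iff scaleR_conv_of_real)
    from field_vector_diff_chain_at[OF this DERIV_exp]
    show "((\<lambda>h. wave (z + of_real h * z') (\<beta> + h * \<beta>') x \<xi>) has_vector_derivative ?b * wave z \<beta> x \<xi>) (at 0)"
      unfolding expand by (simp add: o_def wave_def)
  qed
  fix h :: real and \<xi> :: 'a assume h: "\<bar>h\<bar> \<le> 1/2"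
  let ?a = "\<lambda>h. - ((z + of_real h * z') * of_real (norm \<xi>)) - \<i> * of_real ((\<beta> + h * \<beta>') * (\<xi> \<bullet> x))"
  have R: "Re (?a k) \<le> - (1/2) * norm \<xi>" if "\<bar>k\<bar> \<le> 1/2" for k
    using mult_right_mono[OF Re[OF that], of "norm \<xi>"] by simp
  have "norm (wave (z + of_real h * z') (\<beta> + h * \<beta>') x \<xi> - wave (z + of_real 0 * z') (\<beta> + 0 * \<beta>') x \<xi>)
     \<le> exp (- (1/2) * norm \<xi>) * norm (?a h - ?a 0)"
    unfolding wave_def using R[OF h] R[of 0] by (intro norm_exp_diff_le) auto
  also have "?a h - ?a 0 = of_real h * (- (z' * of_real (norm \<xi>) + \<i> * of_real (\<beta>' * (\<xi> \<bullet> x))))"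
    by (simp add: algebra_simps)
  also have "norm \<dots> \<le> \<bar>h\<bar> * (norm z' * norm \<xi> + \<bar>\<beta>'\<bar> * (norm x * norm \<xi>))"
  proof -
    have "norm (z' * of_real (norm \<xi>) + \<i> * of_real (\<beta>' * (\<xi> \<bullet> x))) \<le> norm z' * norm \<xi> + \<bar>\<beta>'\<bar> * \<bar>\<xi> \<bullet> x\<bar>"
      by (rule order_trans[OF norm_triangle_ineq]) (simp add: norm_mult abs_mult)
    also have "\<dots> \<le> norm z' * norm \<xi> + \<bar>\<beta>'\<bar> * (norm x * norm \<xi>)"
      using Cauchy_Schwarz_ineq2[of \<xi> x] by (intro add_left_mono mult_left_mono) (auto simp: mult.commute)
    finally show ?thesis unfolding norm_mult norm_minus_cancel norm_of_real by (intro mult_left_mono) auto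
  qed
  finally show "norm (wave (z + of_real h * z') (\<beta> + h * \<beta>') x \<xi> - wave (z + of_real 0 * z') (\<beta> + 0 * \<beta>') x \<xi>)
     \<le> \<bar>h\<bar> * ((norm z' + \<bar>\<beta>'\<bar> * norm x) * (norm \<xi> ^ 1 * exp (- (1/2) * norm \<xi>)))"
    by (simp add: algebra_simps)
qed (auto simp: z)

lemma integral_wave_scale:
  fixes x :: "'a::euclidean_space"
  assumes "c > 0"
  shows "of_real c ^ DIM('a) * (\<integral>\<xi>. wave (of_real c * z) (c * \<beta>) x \<xi> \<partial>lborel) = (\<integral>\<xi>. wave z \<beta> x \<xi> \<partial>lborel)"
proof -
  have "wave z \<beta> x (0 + c *\<^sub>R \<xi>) = wave (of_real c * z) (c * \<beta>) x \<xi>" for \<xi>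
    using assms by (simp add: wave_def mult_ac)
  then show ?thesis
    using integral_lborel_affine[of "wave z \<beta> x" c 0] assms by simp
qed

lemma has_vector_derivative_locally_constant:
  fixes F :: "real \<Rightarrow> complex"
  assumes "(F has_vector_derivative D) (at 0)" and "\<And>h. \<bar>h\<bar> < 1 \<Longrightarrow> F h = c"
  shows "D = 0"
proof -
  have "(F has_vector_derivative 0) (at 0)"
    by (rule has_vector_derivative_transform_within_open[OF has_vector_derivative_const, where S="{-1<..<1}"])
       (auto simp: assms(2))
  with assms(1) show ?thesis by (rule vector_derivative_unique_at)
qed

text \<open>
  By homogeneity of Lebesgue measure, \<open>(1 + h) ^ DIM('a)\<close> times the integral with both parameters
  multiplied by \<open>1 + h\<close> does not depend on \<open>h\<close>; the identity says that its derivative at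
  \<open>h = 0\<close> vanishes.
\<close>
lemma wave_scaling_identity:
  fixes x :: "'a::euclidean_space"
  assumes z: "Re z = 1"
  shows "of_nat DIM('a) * (\<integral>\<xi>. wave z \<beta> x \<xi> \<partial>lborel) =
    (\<integral>\<xi>. (z * of_real (norm \<xi>) + \<i> * of_real (\<beta> * (\<xi> \<bullet> x))) * wave z \<beta> x \<xi> \<partial>lborel)"
proof -
  let ?A = "\<integral>\<xi>. wave z \<beta> x \<xi> \<partial>lborel"
  let ?D = "\<integral>\<xi>. (z * of_real (norm \<xi>) + \<i> * of_real (\<beta> * (\<xi> \<bullet> x))) * wave z \<beta> x \<xi> \<partial>lborel"
  have "((\<lambda>h. \<integral>\<xi>. wave (z + of_real h * z) (\<beta> + h * \<beta>) x \<xi> \<partial>lborel) has_vector_derivative - ?D) (at 0)"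
    using integral_wave_has_derivative[of z z \<beta> \<beta> x] z
    by (simp only: mult_minus_left integral_minus abs_one order_refl)
  then have "((\<lambda>h. of_real (1 + h) ^ DIM('a) * (\<integral>\<xi>. wave (z + of_real h * z) (\<beta> + h * \<beta>) x \<xi> \<partial>lborel)) has_vector_derivative
      (of_real (1 + 0) ^ DIM('a) * (- ?D) + of_nat DIM('a) * of_real (1 + 0) ^ (DIM('a) - 1) * (\<integral>\<xi>. wave (z + of_real 0 * z) (\<beta> + 0 * \<beta>) x \<xi> \<partial>lborel))) (at 0)"
    by (intro has_vector_derivative_mult) (auto intro!: derivative_eq_intros simp: has_vector_derivative_def fun_eq_iff scaleR_conv_of_real)
  then have "of_real (1 + 0) ^ DIM('a) * (- ?D) + of_nat DIM('a) * of_real (1 + 0) ^ (DIM('a) - 1) * (\<integral>\<xi>. wave (z + of_real 0 * z) (\<beta> + 0 * \<beta>) x \<xi> \<partial>lborel) = 0"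
  proof (rule has_vector_derivative_locally_constant)
    fix h :: real assume "\<bar>h\<bar> < 1"
    then have "of_real (1 + h) ^ DIM('a) * (\<integral>\<xi>. wave (of_real (1 + h) * z) ((1 + h) * \<beta>) x \<xi> \<partial>lborel) = ?A"
      by (intro integral_wave_scale) auto
    then show "of_real (1 + h) ^ DIM('a) * (\<integral>\<xi>. wave (z + of_real h * z) (\<beta> + h * \<beta>) x \<xi> \<partial>lborel) = ?A"
      by (simp add: algebra_simps)
  qed
  then show ?thesis by simp
qed

lemma norm_line_has_real_derivative:
  fixes \<xi> x :: "'a::euclidean_space"
  assumes "\<xi> \<noteq> 0"
  shows "((\<lambda>h. norm (\<xi> + h *\<^sub>R x)) has_real_derivative (\<xi> \<bullet> x / norm \<xi>)) (at 0)"
proof -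
  have "((\<lambda>h. norm (\<xi> + h *\<^sub>R x)) has_derivative (\<lambda>h. (h *\<^sub>R x) \<bullet> sgn (\<xi> + 0 *\<^sub>R x))) (at 0)"
    using assms by (intro has_derivative_compose[OF _ has_derivative_norm] derivative_eq_intros) auto
  then show ?thesis
    by (simp add: has_real_derivative_iff_has_vector_derivative has_vector_derivative_def sgn_div_norm inner_commute field_simps)
qed

text \<open>
  Translation invariance of Lebesgue measure in the direction \<open>x\<close>, differentiated: an integration
  by parts that tolerates the kink of the norm at the origin. The multiplier \<open>m\<close> is
  meant to be \<open>1\<close> or the norm.
\<close>
lemma wave_translation_identity:
  fixes x :: "'a::euclidean_space" and m m' :: "'a \<Rightarrow> real"
  assumes z: "Re z = 1"
    and [measurable]: "m \<in> borel_measurable borel" "m' \<in> borel_measurable borel"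
    and lip: "\<And>\<xi> v. \<bar>m (\<xi> + v) - m \<xi>\<bar> \<le> norm v"
    and m: "\<And>\<xi>. \<bar>m \<xi>\<bar> \<le> 1 + norm \<xi>"
    and m': "\<And>\<xi>. \<xi> \<noteq> 0 \<Longrightarrow> ((\<lambda>h. m (\<xi> + h *\<^sub>R x)) has_real_derivative m' \<xi>) (at 0)"
  shows "(\<integral>\<xi>. (of_real (m' \<xi>) - of_real (m \<xi>) * (z * of_real (\<xi> \<bullet> x / norm \<xi>) + \<i> * of_real (\<beta> * (x \<bullet> x)))) * wave z \<beta> x \<xi> \<partial>lborel) = 0"
proof -
  let ?w = "wave z \<beta> x"
  let ?f = "\<lambda>h \<xi>. of_real (m (\<xi> + h *\<^sub>R x)) * ?w (\<xi> + h *\<^sub>R x)"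
  define K where "K = norm z + \<bar>\<beta>\<bar> * norm x"
  have K: "K \<ge> 0" by (simp add: K_def)
  have int1: "integrable lborel (\<lambda>\<xi>::'a. exp (- norm \<xi>))" "integrable lborel (\<lambda>\<xi>::'a. norm \<xi> * exp (- norm \<xi>))"
    using integrable_norm_power_exp[of 1 0] integrable_norm_power_exp[of 1 1] by auto
  then have int2: "integrable lborel (\<lambda>\<xi>::'a. (1 + norm \<xi>) * exp (- norm \<xi>))"
    by (simp add: distrib_right)
  have shift: "norm \<xi> \<le> norm (\<xi> + h *\<^sub>R x) + norm x" if "\<bar>h\<bar> \<le> 1/2" for h and \<xi> :: 'a
  proof -
    have "norm (h *\<^sub>R x) \<le> norm x" using that mult_right_mono[of "\<bar>h\<bar>" 1 "norm x"] by simp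
    then show ?thesis using norm_triangle_ineq4[of "\<xi> + h *\<^sub>R x" "h *\<^sub>R x"] by simp
  qed
  have shift_exp: "exp (- norm (\<xi> + h *\<^sub>R x)) \<le> exp (norm x) * exp (- norm \<xi>)" if "\<bar>h\<bar> \<le> 1/2" for h and \<xi> :: 'a
    using shift[OF that, of \<xi>] by (simp flip: exp_add)
  have "((\<lambda>h. \<integral>\<xi>. ?f h \<xi> \<partial>lborel) has_vector_derivative
     (\<integral>\<xi>. (of_real (m' \<xi>) - of_real (m \<xi>) * (z * of_real (\<xi> \<bullet> x / norm \<xi>) + \<i> * of_real (\<beta> * (x \<bullet> x)))) * ?w \<xi> \<partial>lborel)) (at 0)"
  proof (rule has_vector_derivative_integral_dominated[where \<delta>="1/2" and g="\<lambda>\<xi>. norm x * exp (norm x) * (1 + K) * ((1 + norm \<xi>) * exp (- norm \<xi>))"])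
    show "integrable lborel (\<lambda>\<xi>::'a. norm x * exp (norm x) * (1 + K) * ((1 + norm \<xi>) * exp (- norm \<xi>)))"
      by (intro integrable_mult_right int2)
    show "integrable lborel (?f h)" if h: "\<bar>h\<bar> \<le> 1/2" for h
    proof (rule Bochner_Integration.integrable_bound[OF integrable_mult_right[OF int2, of "(1 + norm x) * exp (norm x)"]])
      show "AE \<xi> in lborel. norm (?f h \<xi>) \<le> norm ((1 + norm x) * exp (norm x) * ((1 + norm \<xi>) * exp (- norm \<xi>)))"
      proof (rule AE_I2)
        fix \<xi> :: 'a
        have "norm (h *\<^sub>R x) \<le> norm x" using h mult_right_mono[of "\<bar>h\<bar>" 1 "norm x"] by simp
        then have "norm (\<xi> + h *\<^sub>R x) \<le> norm \<xi> + norm x" by (meson add_left_mono norm_triangle_ineq order_trans)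
        then have "\<bar>m (\<xi> + h *\<^sub>R x)\<bar> \<le> 1 + norm \<xi> + norm x" using m[of "\<xi> + h *\<^sub>R x"] by linarith
        also have "\<dots> \<le> (1 + norm x) * (1 + norm \<xi>)" by (simp add: algebra_simps)
        finally have "\<bar>m (\<xi> + h *\<^sub>R x)\<bar> * exp (- norm (\<xi> + h *\<^sub>R x)) \<le> ((1 + norm x) * (1 + norm \<xi>)) * (exp (norm x) * exp (- norm \<xi>))"
          by (intro mult_mono shift_exp h) auto
        then show "norm (?f h \<xi>) \<le> norm ((1 + norm x) * exp (norm x) * ((1 + norm \<xi>) * exp (- norm \<xi>)))"
          by (simp add: norm_mult norm_wave z abs_mult mult_ac)
      qed
    qed measurable
    show "AE \<xi> in lborel. ((\<lambda>h. ?f h \<xi>) has_vector_derivative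
       (of_real (m' \<xi>) - of_real (m \<xi>) * (z * of_real (\<xi> \<bullet> x / norm \<xi>) + \<i> * of_real (\<beta> * (x \<bullet> x)))) * ?w \<xi>) (at 0)"
      using AE_lborel_singleton[of "0::'a"]
    proof eventually_elim
      case (elim \<xi>)
      note n = norm_line_has_real_derivative[OF elim, of x]
      have e: "((\<lambda>h. - (z * of_real (norm (\<xi> + h *\<^sub>R x))) - \<i> * of_real (\<beta> * ((\<xi> + h *\<^sub>R x) \<bullet> x))) has_vector_derivative
         - (z * of_real (\<xi> \<bullet> x / norm \<xi>)) - \<i> * of_real (\<beta> * (x \<bullet> x))) (at 0)"
        by (intro has_vector_derivative_diff has_vector_derivative_minus has_vector_derivative_mult_right has_vector_derivative_of_real n)
           (auto intro!: derivative_eq_intros simp: algebra_simps simp flip: has_real_derivative_iff_has_vector_derivative)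
      have "((exp \<circ> (\<lambda>h. - (z * of_real (norm (\<xi> + h *\<^sub>R x))) - \<i> * of_real (\<beta> * ((\<xi> + h *\<^sub>R x) \<bullet> x)))) has_vector_derivative
         (- (z * of_real (\<xi> \<bullet> x / norm \<xi>)) - \<i> * of_real (\<beta> * (x \<bullet> x))) * ?w \<xi>) (at 0)"
        using field_vector_diff_chain_at[OF e DERIV_exp] by (simp add: wave_def)
      then have w: "((\<lambda>h. ?w (\<xi> + h *\<^sub>R x)) has_vector_derivative
         (- (z * of_real (\<xi> \<bullet> x / norm \<xi>)) - \<i> * of_real (\<beta> * (x \<bullet> x))) * ?w \<xi>) (at 0)"
        by (simp add: o_def wave_def)
      show ?case
        using has_vector_derivative_mult[OF has_vector_derivative_of_real[OF m'[OF elim]] w]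
        by (simp add: algebra_simps)
    qed
    fix h :: real and \<xi> :: 'a assume h: "\<bar>h\<bar> \<le> 1/2"
    let ?e = "\<lambda>\<xi>. - (z * of_real (norm \<xi>)) - \<i> * of_real (\<beta> * (\<xi> \<bullet> x))"
    let ?X = "exp (norm x) * exp (- norm \<xi>)"
    have X: "?X = exp (norm x - norm \<xi>)" by (simp flip: exp_add)
    have "norm (?w (\<xi> + h *\<^sub>R x) - ?w \<xi>) \<le> exp (norm x - norm \<xi>) * norm (?e (\<xi> + h *\<^sub>R x) - ?e \<xi>)"
      unfolding wave_def using shift[OF h, of \<xi>] z by (intro norm_exp_diff_le) auto
    also have "?e (\<xi> + h *\<^sub>R x) - ?e \<xi> = - (z * of_real (norm (\<xi> + h *\<^sub>R x) - norm \<xi>)) - \<i> * of_real (\<beta> * (h * (x \<bullet> x)))"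
      by (simp add: algebra_simps)
    also have "norm \<dots> \<le> norm z * (\<bar>h\<bar> * norm x) + \<bar>\<beta>\<bar> * (\<bar>h\<bar> * (norm x * norm x))"
    proof (rule order_trans[OF norm_triangle_ineq4], rule add_mono)
      show "norm (- (z * of_real (norm (\<xi> + h *\<^sub>R x) - norm \<xi>))) \<le> norm z * (\<bar>h\<bar> * norm x)"
        unfolding norm_minus_cancel norm_mult norm_of_real
        using norm_triangle_ineq3[of "\<xi> + h *\<^sub>R x" \<xi>] by (intro mult_left_mono) auto
    qed (simp add: norm_mult abs_mult power2_norm_eq_inner flip: power2_eq_square)
    also have "\<dots> = \<bar>h\<bar> * norm x * K" by (simp add: K_def algebra_simps)
    finally have dw: "norm (?w (\<xi> + h *\<^sub>R x) - ?w \<xi>) \<le> ?X * (\<bar>h\<bar> * norm x * K)"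
      unfolding X by simp
    have "?f h \<xi> - ?f 0 \<xi> = of_real (m (\<xi> + h *\<^sub>R x) - m \<xi>) * ?w (\<xi> + h *\<^sub>R x) + of_real (m \<xi>) * (?w (\<xi> + h *\<^sub>R x) - ?w \<xi>)"
      by (simp add: algebra_simps)
    also have "norm \<dots> \<le> \<bar>m (\<xi> + h *\<^sub>R x) - m \<xi>\<bar> * exp (- norm (\<xi> + h *\<^sub>R x)) + \<bar>m \<xi>\<bar> * norm (?w (\<xi> + h *\<^sub>R x) - ?w \<xi>)"
      by (rule order_trans[OF norm_triangle_ineq]) (simp add: norm_mult norm_wave z flip: of_real_diff)
    also have "\<dots> \<le> (\<bar>h\<bar> * norm x) * ?X + (1 + norm \<xi>) * (?X * (\<bar>h\<bar> * norm x * K))"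
      using lip[of \<xi> "h *\<^sub>R x"] by (intro add_mono mult_mono shift_exp h m dw) auto
    also have "\<dots> \<le> (1 + norm \<xi>) * ((\<bar>h\<bar> * norm x) * ?X) + (1 + norm \<xi>) * (?X * (\<bar>h\<bar> * norm x * K))"
    proof (intro add_right_mono)
      show "(\<bar>h\<bar> * norm x) * ?X \<le> (1 + norm \<xi>) * ((\<bar>h\<bar> * norm x) * ?X)"
        using mult_right_mono[of 1 "1 + norm \<xi>" "(\<bar>h\<bar> * norm x) * ?X"] by simp
    qed
    also have "\<dots> = \<bar>h\<bar> * (norm x * exp (norm x) * (1 + K) * ((1 + norm \<xi>) * exp (- norm \<xi>)))"
      by (simp add: algebra_simps)
    finally show "norm (?f h \<xi> - ?f 0 \<xi>) \<le> \<bar>h\<bar> * (norm x * exp (norm x) * (1 + K) * ((1 + norm \<xi>) * exp (- norm \<xi>)))" .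
  qed auto
  then show ?thesis
  proof (rule has_vector_derivative_locally_constant)
    fix h :: real
    show "(\<integral>\<xi>. ?f h \<xi> \<partial>lborel) = (\<integral>\<xi>. of_real (m \<xi>) * ?w \<xi> \<partial>lborel)"
      using integral_lborel_affine[of "\<lambda>\<xi>. of_real (m \<xi>) * ?w \<xi>" 1 "h *\<^sub>R x"] by (simp add: add.commute)
  qed
qed

section \<open>The complexified Poisson kernel\<close>

lemma integrable_norm_wave:
  assumes z: "Re z > 0" shows "integrable lborel (\<lambda>\<xi>. of_real (norm \<xi>) * wave z \<beta> x \<xi>)"
  by (rule integrable_mult_wave[where K=1 and k=1]) (use z in auto)

lemma integrable_inner_wave:
  assumes z: "Re z > 0" shows "integrable lborel (\<lambda>\<xi>. of_real (\<xi> \<bullet> x) * wave z \<beta> x \<xi>)"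
  by (rule integrable_mult_wave[where K="norm x" and k=1])
     (use z Cauchy_Schwarz_ineq2[of _ x] in \<open>auto simp: mult.commute\<close>)

lemma integrable_sgn_inner_wave:
  assumes z: "Re z > 0" shows "integrable lborel (\<lambda>\<xi>. of_real (\<xi> \<bullet> x / norm \<xi>) * wave z \<beta> x \<xi>)"
proof (rule integrable_mult_wave[where K="norm x" and k=0])
  fix \<xi> :: 'a
  show "norm (of_real (\<xi> \<bullet> x / norm \<xi>) :: complex) \<le> norm x * norm \<xi> ^ 0"
    using Cauchy_Schwarz_ineq2[of \<xi> x] by (cases "\<xi> = 0") (auto simp: field_simps norm_divide)
qed (use z in auto)

lemma integral_sgn_inner_wave:
  fixes x :: "'a::euclidean_space"
  assumes z: "Re z = 1"
  shows "z * (\<integral>\<xi>. of_real (\<xi> \<bullet> x / norm \<xi>) * wave z \<beta> x \<xi> \<partial>lborel) = - \<i> * of_real (\<beta> * (x \<bullet> x)) * (\<integral>\<xi>. wave z \<beta> x \<xi> \<partial>lborel)"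
proof -
  have "0 = (\<integral>\<xi>. (of_real 0 - of_real 1 * (z * of_real (\<xi> \<bullet> x / norm \<xi>) + \<i> * of_real (\<beta> * (x \<bullet> x)))) * wave z \<beta> x \<xi> \<partial>lborel)"
    by (rule wave_translation_identity[symmetric]) (auto simp: z)
  also have "\<dots> = (\<integral>\<xi>. - z * (of_real (\<xi> \<bullet> x / norm \<xi>) * wave z \<beta> x \<xi>) + - (\<i> * of_real (\<beta> * (x \<bullet> x))) * wave z \<beta> x \<xi> \<partial>lborel)"
    by (intro Bochner_Integration.integral_cong) (auto simp: algebra_simps)
  also have "\<dots> = - z * (\<integral>\<xi>. of_real (\<xi> \<bullet> x / norm \<xi>) * wave z \<beta> x \<xi> \<partial>lborel) + - (\<i> * of_real (\<beta> * (x \<bullet> x))) * (\<integral>\<xi>. wave z \<beta> x \<xi> \<partial>lborel)"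
    by (subst Bochner_Integration.integral_add) (auto intro!: integrable_mult_right integrable_sgn_inner_wave integrable_wave simp: z simp del: of_real_divide of_real_mult)
  finally have eq: "0 = \<dots>" .
  have "a * b = - c * e" if "0 = - a * b + - c * e" for a b c e :: complex
    using that by algebra
  from this[OF eq] show ?thesis by simp
qed

lemma integral_sgn_inner_wave_eq_moments:
  fixes x :: "'a::euclidean_space"
  assumes z: "Re z = 1"
  shows "(\<integral>\<xi>. of_real (\<xi> \<bullet> x / norm \<xi>) * wave z \<beta> x \<xi> \<partial>lborel) =
     z * (\<integral>\<xi>. of_real (\<xi> \<bullet> x) * wave z \<beta> x \<xi> \<partial>lborel) + \<i> * of_real (\<beta> * (x \<bullet> x)) * (\<integral>\<xi>. of_real (norm \<xi>) * wave z \<beta> x \<xi> \<partial>lborel)"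
proof -
  have "0 = (\<integral>\<xi>. (of_real (\<xi> \<bullet> x / norm \<xi>) - of_real (norm \<xi>) * (z * of_real (\<xi> \<bullet> x / norm \<xi>) + \<i> * of_real (\<beta> * (x \<bullet> x)))) * wave z \<beta> x \<xi> \<partial>lborel)"
  proof (rule wave_translation_identity[symmetric])
    show "((\<lambda>h. norm (\<xi> + h *\<^sub>R x)) has_real_derivative (\<xi> \<bullet> x / norm \<xi>)) (at 0)" if "\<xi> \<noteq> 0" for \<xi> :: 'a
      using that by (rule norm_line_has_real_derivative)
    show "\<bar>norm (\<xi> + v) - norm \<xi>\<bar> \<le> norm v" for \<xi> v :: 'a
      using norm_triangle_ineq3[of "\<xi> + v" \<xi>] by simp
  qed (auto simp: z)
  also have "\<dots> = (\<integral>\<xi>. of_real (\<xi> \<bullet> x / norm \<xi>) * wave z \<beta> x \<xi> + (- z * (of_real (\<xi> \<bullet> x) * wave z \<beta> x \<xi>) + - (\<i> * of_real (\<beta> * (x \<bullet> x))) * (of_real (norm \<xi>) * wave z \<beta> x \<xi>)) \<partial>lborel)"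
    by (intro Bochner_Integration.integral_cong) (auto simp: algebra_simps)
  also have "\<dots> = (\<integral>\<xi>. of_real (\<xi> \<bullet> x / norm \<xi>) * wave z \<beta> x \<xi> \<partial>lborel) + (- z * (\<integral>\<xi>. of_real (\<xi> \<bullet> x) * wave z \<beta> x \<xi> \<partial>lborel) + - (\<i> * of_real (\<beta> * (x \<bullet> x))) * (\<integral>\<xi>. of_real (norm \<xi>) * wave z \<beta> x \<xi> \<partial>lborel))"
    by (subst Bochner_Integration.integral_add Bochner_Integration.integral_add integral_mult_right_zero, (intro Bochner_Integration.integrable_add integrable_mult_right integrable_sgn_inner_wave integrable_inner_wave integrable_norm_wave; simp add: z)+)+ simp
  finally have eq: "0 = \<dots>" .
  have "u = a * b + c * e" if "0 = u + (- a * b + - c * e)" for a b c e u :: complex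
    using that by algebra
  from this[OF eq] show ?thesis .
qed

lemma wave_disc_nonpos:
  fixes x :: "'a::euclidean_space"
  assumes z: "Re z = 1"
  shows "z\<^sup>2 + of_real (\<beta>\<^sup>2 * (x \<bullet> x)) \<notin> \<real>\<^sub>\<le>\<^sub>0"
proof
  assume "z\<^sup>2 + of_real (\<beta>\<^sup>2 * (x \<bullet> x)) \<in> \<real>\<^sub>\<le>\<^sub>0"
  then have "Im z = 0" "1 + \<beta>\<^sup>2 * (x \<bullet> x) \<le> (Im z)\<^sup>2" using z by (auto simp: complex_nonpos_Reals_iff power2_eq_square)
  moreover have "\<beta>\<^sup>2 * (x \<bullet> x) \<ge> 0" by simp
  ultimately show False by simp
qed

text \<open>
  The scaling identity and the translation identities for the multipliers \<open>1\<close> and \<open>norm\<close> are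
  three linear equations for the moments of \<open>norm \<xi>\<close>, \<open>\<xi> \<bullet> x\<close> and \<open>\<xi> \<bullet> x / norm \<xi>\<close>, with
  multiples of the plain integral on the right-hand side. Up to sign, the determinant of the system is \<open>z * D\<close>.
\<close>
lemma integral_moments_wave:
  fixes x :: "'a::euclidean_space" and \<beta> :: real and z :: complex
  assumes z: "Re z = 1"
  defines "D \<equiv> z\<^sup>2 + of_real (\<beta>\<^sup>2 * (x \<bullet> x))"
    and "A \<equiv> \<integral>\<xi>. wave z \<beta> x \<xi> \<partial>lborel"
  shows "(\<integral>\<xi>. of_real (norm \<xi>) * wave z \<beta> x \<xi> \<partial>lborel) = (of_nat DIM('a) * z\<^sup>2 - of_real (\<beta>\<^sup>2 * (x \<bullet> x))) / (z * D) * A" (is "?A1 = _")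
    and "(\<integral>\<xi>. of_real (\<xi> \<bullet> x) * wave z \<beta> x \<xi> \<partial>lborel) = - \<i> * of_real (\<beta> * (x \<bullet> x)) * of_nat (DIM('a) + 1) / D * A" (is "?B0 = _")
proof -
  define A1 where "A1 = ?A1"
  define B0 where "B0 = ?B0"
  define Y where "Y = (of_real (\<beta> * (x \<bullet> x)) :: complex)"
  define b where "b = (of_real \<beta> :: complex)"
  define d where "d = (of_nat DIM('a) :: complex)"
  let ?Bm = "\<integral>\<xi>. of_real (\<xi> \<bullet> x / norm \<xi>) * wave z \<beta> x \<xi> \<partial>lborel"
  have z0: "z \<noteq> 0" using z by auto
  have D: "D = z\<^sup>2 + b * Y" by (simp add: D_def b_def Y_def power2_eq_square)
  have D0: "D \<noteq> 0" using wave_disc_nonpos[OF z, of \<beta> x] unfolding D_def by auto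
  have e1: "z * ?Bm = - \<i> * Y * A" unfolding Y_def A_def by (rule integral_sgn_inner_wave[OF z])
  have e2: "?Bm = z * B0 + \<i> * Y * A1" unfolding Y_def A1_def B0_def by (rule integral_sgn_inner_wave_eq_moments[OF z])
  have e3: "d * A = z * A1 + \<i> * b * B0"
  proof -
    have "d * A = (\<integral>\<xi>. z * (of_real (norm \<xi>) * wave z \<beta> x \<xi>) + (\<i> * b) * (of_real (\<xi> \<bullet> x) * wave z \<beta> x \<xi>) \<partial>lborel)"
      unfolding d_def A_def wave_scaling_identity[OF z] by (intro Bochner_Integration.integral_cong) (auto simp: algebra_simps b_def)
    also have "\<dots> = z * A1 + (\<i> * b) * B0"
      unfolding A1_def B0_def
      by (subst Bochner_Integration.integral_add) (auto intro!: integrable_mult_right integrable_norm_wave integrable_inner_wave simp: z)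
    finally show ?thesis by simp
  qed
  have e4: "z * (z * B0 + \<i> * Y * A1) = - \<i> * Y * A" using e1 e2 by simp
  have "A1 * z * D = (d * z\<^sup>2 - b * Y) * A"
  proof -
    have "A1 * z * D = z\<^sup>2 * (z * A1 + \<i> * b * B0) - \<i> * b * (z * (z * B0 + \<i> * Y * A1))"
      unfolding D by (simp add: power2_eq_square algebra_simps)
    also have "\<dots> = (d * z\<^sup>2 - b * Y) * A"
      unfolding e3[symmetric] e4 by (simp add: power2_eq_square algebra_simps)
    finally show ?thesis .
  qed
  then have a1: "A1 = (d * z\<^sup>2 - b * Y) / (z * D) * A" using z0 D0 by (simp add: field_simps)
  have "z * B0 * D = z * (- \<i> * Y * (d + 1) * A)"
  proof -
    have "z * B0 * D = z * (z * (z * B0 + \<i> * Y * A1)) - z * \<i> * Y * (z * A1 + \<i> * b * B0)"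
      unfolding D by (simp add: power2_eq_square algebra_simps)
    also have "\<dots> = z * (- \<i> * Y * (d + 1) * A)"
      unfolding e3[symmetric] e4 by (simp add: power2_eq_square algebra_simps)
    finally show ?thesis .
  qed
  then have "B0 * D = - \<i> * Y * (d + 1) * A" using z0 by (simp only: mult.assoc mult_left_cancel simp_thms)
  then have b0: "B0 = - \<i> * Y * (d + 1) / D * A" using D0 by (simp add: field_simps)
  show "?A1 = (of_nat DIM('a) * z\<^sup>2 - of_real (\<beta>\<^sup>2 * (x \<bullet> x))) / (z * D) * A"
    using a1 by (simp add: A1_def d_def b_def Y_def power2_eq_square mult_ac)
  show "?B0 = - \<i> * of_real (\<beta> * (x \<bullet> x)) * of_nat (DIM('a) + 1) / D * A"
    using b0 by (simp add: B0_def d_def Y_def add.commute)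
qed

definition exp_mass :: "'a::euclidean_space itself \<Rightarrow> real" where
  "exp_mass _ = (\<integral>(\<xi>::'a). exp (- norm \<xi>) \<partial>lborel)"

lemma exp_mass_pos: "exp_mass TYPE('a::euclidean_space) > 0"
proof -
  have int: "integrable lborel (\<lambda>\<xi>::'a. exp (- norm \<xi>))"
    using integrable_norm_power_exp[of 1 0] by simp
  have "exp_mass TYPE('a) \<noteq> 0"
  proof
    assume "exp_mass TYPE('a) = 0"
    then have "AE \<xi>::'a in lborel. exp (- norm \<xi>) = 0"
      using integral_nonneg_eq_0_iff_AE[OF int] by (auto simp: exp_mass_def)
    then have "AE \<xi>::'a in lborel. False" by simp
    then have "emeasure lborel (UNIV :: 'a set) = 0" by (auto simp: AE_iff_measurable[OF _ refl])
    then show False by simp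
  qed
  moreover have "exp_mass TYPE('a) \<ge> 0" unfolding exp_mass_def by (rule integral_nonneg_AE) simp
  ultimately show ?thesis by simp
qed

text \<open>
  For real \<open>z\<close> this is the classical formula for the Fourier transform of \<open>exp (- norm \<xi>)\<close>. Along
  the ray \<open>r \<mapsto> (r * x, r * s)\<close> the derivative of the integral is a combination of first moments,
  hence a multiple of the integral itself, and the multiplier is the logarithmic derivative of
  \<open>z / csqrt D ^ (DIM('a) + 1)\<close>. Writing the half-integer power through \<open>csqrt\<close> fixes its branch,
  since \<open>D\<close> is never a nonpositive real.
\<close>
lemma integral_wave:
  fixes x :: "'a::euclidean_space" and s :: real
  defines "z \<equiv> 1 + \<i> * of_real s"
  shows "(\<integral>\<xi>. wave z 1 x \<xi> \<partial>lborel) = of_real (exp_mass TYPE('a)) * z / csqrt (z\<^sup>2 + of_real (x \<bullet> x)) ^ (DIM('a) + 1)"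
proof -
  define Z where "Z r = 1 + \<i> * of_real (r * s)" for r
  define D where "D r = (Z r)\<^sup>2 + of_real (r\<^sup>2 * (x \<bullet> x))" for r
  define A where "A r = (\<integral>\<xi>. wave (Z r) r x \<xi> \<partial>lborel)" for r
  define S where "S r = csqrt (D r)" for r
  define P where "P r = A r * S r ^ (DIM('a) + 1) / Z r" for r
  define X where "X = (of_real (x \<bullet> x) :: complex)"
  define d where "d = (of_nat DIM('a) :: complex)"
  have ReZ: "Re (Z r) = 1" for r by (simp add: Z_def)
  have Z0: "Z r \<noteq> 0" for r using ReZ[of r] by auto
  have Dn: "D r \<notin> \<real>\<^sub>\<le>\<^sub>0" for r unfolding D_def by (rule wave_disc_nonpos[OF ReZ])
  have S0: "S r \<noteq> 0" for r using Dn[of r] by (auto simp: S_def)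
  have SD: "S r ^ 2 = D r" for r by (simp add: S_def)
  have dA: "(A has_vector_derivative
     (- (\<i> * of_real s * (d * (Z r)\<^sup>2 - of_real r ^ 2 * X) / (Z r * D r)) - of_real r * X * (d + 1) / D r) * A r) (at r)" for r
  proof -
    have "((\<lambda>h. \<integral>\<xi>. wave (Z r + of_real h * (\<i> * of_real s)) (r + h * 1) x \<xi> \<partial>lborel) has_vector_derivative
      (\<integral>\<xi>. - ((\<i> * of_real s) * of_real (norm \<xi>) + \<i> * of_real (1 * (\<xi> \<bullet> x))) * wave (Z r) r x \<xi> \<partial>lborel)) (at 0)"
      by (rule integral_wave_has_derivative) (auto simp: ReZ)
    also have "(\<lambda>h. \<integral>\<xi>. wave (Z r + of_real h * (\<i> * of_real s)) (r + h * 1) x \<xi> \<partial>lborel) = (\<lambda>h. A (r + h))"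
      by (simp add: A_def Z_def algebra_simps)
    also have "(\<integral>\<xi>. - ((\<i> * of_real s) * of_real (norm \<xi>) + \<i> * of_real (1 * (\<xi> \<bullet> x))) * wave (Z r) r x \<xi> \<partial>lborel)
      = (\<integral>\<xi>. - (\<i> * of_real s) * (of_real (norm \<xi>) * wave (Z r) r x \<xi>) + - \<i> * (of_real (\<xi> \<bullet> x) * wave (Z r) r x \<xi>) \<partial>lborel)"
      by (intro Bochner_Integration.integral_cong) (auto simp: algebra_simps)
    also have "\<dots> = - (\<i> * of_real s) * (\<integral>\<xi>. of_real (norm \<xi>) * wave (Z r) r x \<xi> \<partial>lborel) + - \<i> * (\<integral>\<xi>. of_real (\<xi> \<bullet> x) * wave (Z r) r x \<xi> \<partial>lborel)"
      by (subst Bochner_Integration.integral_add) (auto intro!: integrable_mult_right integrable_norm_wave integrable_inner_wave simp: ReZ)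
    also have "\<dots> = (- (\<i> * of_real s * (d * (Z r)\<^sup>2 - of_real r ^ 2 * X) / (Z r * D r)) - of_real r * X * (d + 1) / D r) * A r"
      unfolding integral_moments_wave[OF ReZ] D_def[symmetric] A_def[symmetric]
      by (simp add: X_def d_def diff_divide_distrib add_divide_distrib algebra_simps)
    finally have *: "((\<lambda>h. A (r + h)) has_vector_derivative \<dots>) (at 0)" .
    have "((\<lambda>h. A (r + h)) \<circ> (\<lambda>y. y - r) has_vector_derivative 1 *\<^sub>R ((- (\<i> * of_real s * (d * (Z r)\<^sup>2 - of_real r ^ 2 * X) / (Z r * D r)) - of_real r * X * (d + 1) / D r) * A r)) (at r)"
      by (rule vector_diff_chain_at) (use * in \<open>auto intro!: derivative_eq_intros simp flip: has_real_derivative_iff_has_vector_derivative\<close>)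
    then show ?thesis by (simp add: o_def)
  qed
  have dZ: "(Z has_vector_derivative \<i> * of_real s) (at r)" for r
    unfolding Z_def by (auto intro!: derivative_eq_intros simp: has_vector_derivative_def fun_eq_iff scaleR_conv_of_real)
  have dD: "(D has_vector_derivative 2 * \<i> * of_real s * Z r + 2 * of_real r * X) (at r)" for r
    unfolding D_def Z_def by (auto intro!: derivative_eq_intros simp: has_vector_derivative_def fun_eq_iff scaleR_conv_of_real X_def power2_eq_square algebra_simps)
  have dSn: "((\<lambda>r. S r ^ (DIM('a) + 1)) has_vector_derivative (2 * \<i> * of_real s * Z r + 2 * of_real r * X) * ((d + 1) * S r ^ DIM('a) * inverse (2 * S r))) (at r)" for r
  proof -
    have "((\<lambda>w. csqrt w ^ (DIM('a) + 1)) has_field_derivative (of_nat (DIM('a) + 1) * (inverse (2 * csqrt (D r)) * csqrt (D r) ^ (DIM('a) + 1 - Suc 0)))) (at (D r))"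
      by (intro DERIV_power has_field_derivative_csqrt Dn)
    from field_vector_diff_chain_at[OF dD this]
    show ?thesis by (simp add: o_def S_def d_def mult_ac add.commute)
  qed
  have dP: "(P has_vector_derivative 0) (at r)" for r
  proof -
    have dI: "((\<lambda>r. inverse (Z r)) has_vector_derivative (\<i> * of_real s) * - (inverse (Z r) ^ Suc (Suc 0))) (at r)"
      using field_vector_diff_chain_at[OF dZ DERIV_inverse[OF Z0]] by (simp add: o_def)
    have "((\<lambda>r. A r * (S r ^ (DIM('a) + 1) * inverse (Z r))) has_vector_derivative
       (A r * (S r ^ (DIM('a) + 1) * ((\<i> * of_real s) * - (inverse (Z r) ^ Suc (Suc 0)))
          + ((2 * \<i> * of_real s * Z r + 2 * of_real r * X) * ((d + 1) * S r ^ DIM('a) * inverse (2 * S r))) * inverse (Z r))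
        + ((- (\<i> * of_real s * (d * (Z r)\<^sup>2 - of_real r ^ 2 * X) / (Z r * D r)) - of_real r * X * (d + 1) / D r) * A r) * (S r ^ (DIM('a) + 1) * inverse (Z r)))) (at r)"
      by (intro has_vector_derivative_mult dA dSn dI)
    also have "(\<lambda>r. A r * (S r ^ (DIM('a) + 1) * inverse (Z r))) = P"
      by (simp add: P_def fun_eq_iff divide_inverse)
    also have "(A r * (S r ^ (DIM('a) + 1) * ((\<i> * of_real s) * - (inverse (Z r) ^ Suc (Suc 0)))
          + ((2 * \<i> * of_real s * Z r + 2 * of_real r * X) * ((d + 1) * S r ^ DIM('a) * inverse (2 * S r))) * inverse (Z r))
        + ((- (\<i> * of_real s * (d * (Z r)\<^sup>2 - of_real r ^ 2 * X) / (Z r * D r)) - of_real r * X * (d + 1) / D r) * A r) * (S r ^ (DIM('a) + 1) * inverse (Z r)))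
       = A r * S r ^ DIM('a) * (\<i> * of_real s * (of_real r ^ 2 * X + (Z r)\<^sup>2 - (S r)\<^sup>2) / (S r * (Z r)\<^sup>2))"
      using S0[of r] Z0[of r] unfolding SD[of r, symmetric]
      by (simp add: divide_simps) (simp add: algebra_simps power2_eq_square)
    also have "\<dots> = 0" unfolding SD D_def X_def by simp
    finally show ?thesis .
  qed
  \<comment> \<open>The value at \<open>r = 1\<close> is the wanted integral, the one at \<open>r = 0\<close> has no oscillation.\<close>
  have "P constant_on UNIV"
    by (rule has_vector_derivative_zero_constant[OF convex_UNIV, THEN exE])
       (use dP in \<open>auto simp: constant_on_def\<close>)
  then have P10: "P 1 = P 0" by (auto simp: constant_on_def)
  have "wave 1 0 x = (\<lambda>\<xi>. of_real (exp (- norm \<xi>)))"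
    by (simp add: wave_def fun_eq_iff exp_of_real flip: of_real_minus)
  then have "P 0 = of_real (exp_mass TYPE('a))"
    by (simp add: P_def A_def S_def D_def Z_def exp_mass_def)
  with P10 have "A 1 * S 1 ^ (DIM('a) + 1) / Z 1 = of_real (exp_mass TYPE('a))"
    unfolding P_def[of 1] by simp
  then have "A 1 = of_real (exp_mass TYPE('a)) * Z 1 / S 1 ^ (DIM('a) + 1)"
    using Z0[of 1] S0[of 1] by (simp add: field_simps)
  then show ?thesis by (simp add: A_def Z_def S_def D_def z_def)
qed

section \<open>A measure on the cone with optimal decay\<close>

text \<open>
  Both \<open>norm (x, s)\<close> and \<open>norm z\<close> are at most \<open>norm D\<close>, because
  \<open>(norm D)\<^sup>2 = (1 + (norm x + s)\<^sup>2) * (1 + (norm x - s)\<^sup>2)\<close>. So the numerator \<open>z\<close> of the Poisson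
  kernel costs two of the \<open>DIM('a) + 1\<close> factors \<open>sqrt (norm D)\<close> in the denominator.
\<close>
lemma norm_integral_wave_le:
  fixes x :: "'a::euclidean_space" and s :: real
  assumes nz: "(x, s) \<noteq> 0"
  shows "norm (\<integral>\<xi>. wave (1 + \<i> * of_real s) 1 x \<xi> \<partial>lborel)
    \<le> exp_mass TYPE('a) * norm (x, s) powr (- (real DIM('a) - 1) / 2)"
proof -
  let ?n = "norm (x, s)" and ?M = "exp_mass TYPE('a)"
  define z where "z = 1 + \<i> * of_real s"
  define D where "D = z\<^sup>2 + of_real (x \<bullet> x)"
  obtain k where k: "DIM('a) = Suc k" using DIM_positive[where 'a='a] gr0_conv_Suc by blast
  have n: "?n > 0" using nz by simp
  have n2: "?n\<^sup>2 = (norm x)\<^sup>2 + s\<^sup>2" by (simp add: norm_Pair)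
  have "(norm D)\<^sup>2 = (1 - s\<^sup>2 + (norm x)\<^sup>2)\<^sup>2 + (2 * s)\<^sup>2"
    unfolding cmod_power2 by (simp add: D_def z_def power2_norm_eq_inner) (simp add: power2_eq_square)
  also have "\<dots> = (1 + ((norm x)\<^sup>2 + s\<^sup>2)) + ((norm x)\<^sup>2 + s\<^sup>2 + ((norm x)\<^sup>2 - s\<^sup>2)\<^sup>2)"
    by (simp add: power2_eq_square algebra_simps)
  also have "\<dots> \<ge> 1 + ?n\<^sup>2" unfolding n2 by simp
  finally have D2: "1 + ?n\<^sup>2 \<le> (norm D)\<^sup>2" .
  have zD: "norm z \<le> norm D"
  proof (rule power2_le_imp_le)
    have "(norm z)\<^sup>2 = 1 + s\<^sup>2" unfolding cmod_power2 by (simp add: z_def)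
    also have "\<dots> \<le> 1 + ?n\<^sup>2" unfolding n2 by simp
    finally show "(norm z)\<^sup>2 \<le> (norm D)\<^sup>2" using D2 by linarith
  qed simp
  have "?n\<^sup>2 \<le> (norm D)\<^sup>2" using D2 by linarith
  then have nD: "?n \<le> norm D" by (rule power2_le_imp_le) (rule norm_ge_zero)
  then have D0: "norm D > 0" using n by linarith
  have "norm (\<integral>\<xi>. wave z 1 x \<xi> \<partial>lborel) = ?M * norm z / sqrt (norm D) ^ (k + 2)"
    unfolding z_def integral_wave using exp_mass_pos[where 'a='a]
    by (simp add: norm_mult norm_divide norm_power k D_def z_def)
  also have "\<dots> \<le> ?M * norm D / sqrt (norm D) ^ (k + 2)"
    using zD exp_mass_pos[where 'a='a] by (intro divide_right_mono mult_left_mono) auto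
  also have "\<dots> = ?M / sqrt (norm D) ^ k" unfolding power_add using D0 by simp
  also have "\<dots> \<le> ?M / sqrt ?n ^ k"
    using nD n D0 exp_mass_pos[where 'a='a] by (intro divide_left_mono power_mono mult_pos_pos) auto
  also have "\<dots> = ?M * ?n powr (- (real DIM('a) - 1) / 2)"
    using n by (simp add: k powr_half_sqrt[symmetric] powr_powr powr_minus_divide flip: powr_realpow)
  finally show ?thesis by (simp add: z_def)
qed

definition cone_measure :: "('a::euclidean_space \<times> real) measure" where
  "cone_measure = distr (density lborel (\<lambda>\<xi>. ennreal (exp (- norm \<xi>) / exp_mass TYPE('a)))) borel (\<lambda>\<xi>. (\<xi>, norm \<xi>))"

lemma prob_space_cone_measure: "prob_space (cone_measure :: ('a::euclidean_space \<times> real) measure)"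
  unfolding cone_measure_def
proof (rule prob_space.prob_space_distr)
  show "prob_space (density lborel (\<lambda>\<xi>::'a. ennreal (exp (- norm \<xi>) / exp_mass TYPE('a))))"
  proof
    have "integrable lborel (\<lambda>\<xi>::'a. exp (- norm \<xi>))"
      using integrable_norm_power_exp[of 1 0] by simp
    then have "(\<integral>\<^sup>+(\<xi>::'a). ennreal (exp (- norm \<xi>) / exp_mass TYPE('a)) \<partial>lborel) = ennreal (\<integral>(\<xi>::'a). exp (- norm \<xi>) / exp_mass TYPE('a) \<partial>lborel)"
      using exp_mass_pos[where 'a='a] by (intro nn_integral_eq_integral) auto
    also have "(\<integral>(\<xi>::'a). exp (- norm \<xi>) / exp_mass TYPE('a) \<partial>lborel) = 1"
      using exp_mass_pos[where 'a='a] by (simp add: exp_mass_def)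
    finally show "emeasure (density lborel (\<lambda>\<xi>::'a. ennreal (exp (- norm \<xi>) / exp_mass TYPE('a))))
      (space (density lborel (\<lambda>\<xi>::'a. ennreal (exp (- norm \<xi>) / exp_mass TYPE('a))))) = 1"
      by (simp add: emeasure_density)
  qed
  have "(\<lambda>\<xi>::'a. (\<xi>, norm \<xi>)) \<in> borel_measurable borel" by (intro borel_measurable_continuous_onI continuous_intros)
  then show "(\<lambda>\<xi>::'a. (\<xi>, norm \<xi>)) \<in> density lborel (\<lambda>\<xi>. ennreal (exp (- norm \<xi>) / exp_mass TYPE('a))) \<rightarrow>\<^sub>M borel" by simp
qed

lemma fourier_measure_cone_measure:
  fixes a :: "'a::euclidean_space"
  shows "fourier_measure cone_measure (a, b) = (\<integral>\<xi>. wave (1 + \<i> * of_real (2 * pi * b)) 1 ((2 * pi) *\<^sub>R a) \<xi> \<partial>lborel) / of_real (exp_mass TYPE('a))"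
proof -
  have M: "exp_mass TYPE('a) > 0" by (rule exp_mass_pos)
  have [measurable]: "(\<lambda>\<xi>::'a. (\<xi>, norm \<xi>)) \<in> borel_measurable borel" by (intro borel_measurable_continuous_onI continuous_intros)
  have [measurable]: "(\<lambda>x::'a \<times> real. exp (- 2 * of_real pi * \<i> * of_real ((a, b) \<bullet> x))) \<in> borel_measurable borel"
    by measurable
  have "fourier_measure cone_measure (a, b) =
     (\<integral>\<xi>. (exp (- norm \<xi>) / exp_mass TYPE('a)) *\<^sub>R exp (- 2 * of_real pi * \<i> * of_real ((a, b) \<bullet> (\<xi>, norm \<xi>))) \<partial>lborel)"
    unfolding fourier_measure_def cone_measure_def using M
    by (subst integral_distr, simp, simp, subst integral_density) auto
  also have "\<dots> = (\<integral>\<xi>. wave (1 + \<i> * of_real (2 * pi * b)) 1 ((2 * pi) *\<^sub>R a) \<xi> / of_real (exp_mass TYPE('a)) \<partial>lborel)"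
  proof (intro Bochner_Integration.integral_cong refl)
    fix \<xi> :: 'a
    have "wave (1 + \<i> * of_real (2 * pi * b)) 1 ((2 * pi) *\<^sub>R a) \<xi> = exp (of_real (- norm \<xi>) + - 2 * of_real pi * \<i> * of_real ((a, b) \<bullet> (\<xi>, norm \<xi>)))"
      by (simp add: wave_def inner_commute algebra_simps)
    also have "\<dots> = of_real (exp (- norm \<xi>)) * exp (- 2 * of_real pi * \<i> * of_real ((a, b) \<bullet> (\<xi>, norm \<xi>)))"
      unfolding exp_add exp_of_real ..
    finally show "(exp (- norm \<xi>) / exp_mass TYPE('a)) *\<^sub>R exp (- 2 * of_real pi * \<i> * of_real ((a, b) \<bullet> (\<xi>, norm \<xi>)))
      = wave (1 + \<i> * of_real (2 * pi * b)) 1 ((2 * pi) *\<^sub>R a) \<xi> / of_real (exp_mass TYPE('a))"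
      by (simp add: scaleR_conv_of_real)
  qed
  finally show ?thesis by simp
qed

lemma fourier_decay_cone:
  "fourier_decay {(x::'a::euclidean_space, t::real). norm x = \<bar>t\<bar>} (real DIM('a) - 1)"
  unfolding fourier_decay_def
proof (intro exI conjI)
  let ?p = "- (real DIM('a) - 1) / 2"
  show "prob_space (cone_measure :: ('a \<times> real) measure)" by (rule prob_space_cone_measure)
  show "sets (cone_measure :: ('a \<times> real) measure) = sets borel" by (simp add: cone_measure_def)
  have [measurable]: "(\<lambda>\<xi>::'a. (\<xi>, norm \<xi>)) \<in> borel_measurable borel" by (intro borel_measurable_continuous_onI continuous_intros)
  have "closed {y :: 'a \<times> real. norm (fst y) = \<bar>snd y\<bar>}" by (intro closed_Collect_eq continuous_intros)
  then have "{y \<in> space borel. case y of (x::'a, t::real) \<Rightarrow> norm x = \<bar>t\<bar>} \<in> sets borel"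
    by (simp add: case_prod_beta borel_closed)
  then show "AE y in cone_measure. y \<in> {(x::'a, t::real). norm x = \<bar>t\<bar>}"
    unfolding cone_measure_def by (subst AE_distr_iff) (auto simp: case_prod_beta)
  show "(2 * pi) powr ?p > 0" by simp
  show "\<forall>\<xi>::'a \<times> real. \<xi> \<noteq> 0 \<longrightarrow> norm (fourier_measure cone_measure \<xi>) \<le> (2 * pi) powr ?p * norm \<xi> powr ?p"
  proof (intro allI impI)
    fix \<xi> :: "'a \<times> real" assume nz: "\<xi> \<noteq> 0"
    obtain a b where \<xi>: "\<xi> = (a, b)" by (cases \<xi>)
    let ?\<eta> = "((2 * pi) *\<^sub>R a, 2 * pi * b)"
    have \<eta>: "?\<eta> = (2 * pi) *\<^sub>R \<xi>" by (simp add: \<xi>)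
    have M: "exp_mass TYPE('a) > 0" by (rule exp_mass_pos)
    have "?\<eta> \<noteq> 0" unfolding \<eta> using nz by simp
    then have "norm (fourier_measure cone_measure \<xi>) \<le> (exp_mass TYPE('a) * norm ?\<eta> powr ?p) / exp_mass TYPE('a)"
      unfolding \<xi> fourier_measure_cone_measure norm_divide norm_of_real abs_of_pos[OF M]
      using M by (intro divide_right_mono norm_integral_wave_le) auto
    also have "\<dots> = (2 * pi) powr ?p * norm \<xi> powr ?p"
      unfolding \<eta> using M by (simp add: powr_mult)
    finally show "norm (fourier_measure cone_measure \<xi>) \<le> (2 * pi) powr ?p * norm \<xi> powr ?p" .
  qed
qed

section \<open>Weights that keep Fourier decay\<close>

lemma borel_measurable_fst_snd [measurable]:
  "(fst :: 'a::euclidean_space \<times> 'b::euclidean_space \<Rightarrow> 'a) \<in> borel_measurable borel"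
  "(snd :: 'a::euclidean_space \<times> 'b::euclidean_space \<Rightarrow> 'b) \<in> borel_measurable borel"
  by (intro borel_measurable_continuous_onI continuous_intros)+

lemma Fubini_bounded_kernel:
  fixes a :: "'b::euclidean_space \<Rightarrow> complex" and b :: "'b \<Rightarrow> 'c \<Rightarrow> complex"
  assumes \<mu>: "finite_measure \<mu>" and a: "integrable lborel a"
    and b[measurable]: "case_prod b \<in> borel_measurable (lborel \<Otimes>\<^sub>M \<mu>)" and b1: "\<And>u y. norm (b u y) \<le> 1"
  shows "(\<integral>u. a u * (\<integral>y. b u y \<partial>\<mu>) \<partial>lborel) = (\<integral>y. (\<integral>u. a u * b u y \<partial>lborel) \<partial>\<mu>)"
proof -
  interpret finite_measure \<mu> by fact
  interpret pair_sigma_finite lborel \<mu> ..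
  have [measurable]: "a \<in> borel_measurable lborel" using a by auto
  have "integrable (lborel \<Otimes>\<^sub>M \<mu>) (\<lambda>(u, y). a u * b u y)"
  proof (rule Fubini_integrable)
    have bi: "integrable \<mu> (b u)" for u
      by (rule integrable_const_bound[where B=1]) (auto intro: b1)
    show "AE u in lborel. integrable \<mu> (\<lambda>y. case (u, y) of (u, y) \<Rightarrow> a u * b u y)"
      using bi by auto
    show "integrable lborel (\<lambda>u. \<integral>y. norm (case (u, y) of (u, y) \<Rightarrow> a u * b u y) \<partial>\<mu>)"
    proof (rule Bochner_Integration.integrable_bound)
      show "integrable lborel (\<lambda>u. measure \<mu> (space \<mu>) * norm (a u))" using a by auto
      show "AE u in lborel. norm (\<integral>y. norm (case (u, y) of (u, y) \<Rightarrow> a u * b u y) \<partial>\<mu>) \<le> norm (measure \<mu> (space \<mu>) * norm (a u))"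
      proof (rule AE_I2)
        fix u
        have "(\<integral>y. norm (a u) * norm (b u y) \<partial>\<mu>) \<le> (\<integral>y. norm (a u) * 1 \<partial>\<mu>)"
          by (intro integral_mono mult_left_mono b1 integrable_mult_right integrable_norm bi) auto
        moreover have "(\<integral>y. norm (a u) * norm (b u y) \<partial>\<mu>) \<ge> 0" by (intro integral_nonneg_AE) auto
        ultimately show "norm (\<integral>y. norm (case (u, y) of (u, y) \<Rightarrow> a u * b u y) \<partial>\<mu>) \<le> norm (measure \<mu> (space \<mu>) * norm (a u))"
          by (simp add: norm_mult mult.commute)
      qed
    qed measurable
  qed measurable
  from Fubini_integral[of "\<lambda>u y. a u * b u y", OF this] show ?thesis by simp
qed

text \<open>
  An odd weight that has the sign of \<open>t\<close>, vanishes at \<open>0\<close> and is the Fourier transform of an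
  exponentially decreasing function.
\<close>
definition odd_weight :: "real \<Rightarrow> real" where "odd_weight t = t / (1 + t\<^sup>2)"

lemma odd_weight_measurable [measurable]: "odd_weight \<in> borel_measurable borel"
  unfolding odd_weight_def by measurable

text \<open>
  This is the identity for the moment of \<open>\<xi> \<bullet> x / norm \<xi>\<close> on the real line, where that quotient is the
  sign function, combined with the one-dimensional Poisson kernel.
\<close>
lemma odd_weight_eq_integral:
  "of_real (odd_weight t) = \<i> / of_real (exp_mass TYPE(real)) * (\<integral>u. of_real (sgn u * exp (- \<bar>u\<bar>)) * exp (- \<i> * of_real (t * u)) \<partial>lborel)"
proof -
  let ?M = "exp_mass TYPE(real)"
  have M: "?M > 0" by (rule exp_mass_pos)
  have w: "wave 1 \<beta> x u = of_real (exp (- \<bar>u\<bar>)) * exp (- \<i> * of_real (\<beta> * (u * x)))" for \<beta> x u :: real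
  proof -
    have "wave 1 \<beta> x u = exp (of_real (- \<bar>u\<bar>) + (- \<i> * of_real (\<beta> * (u * x))))" by (simp add: wave_def)
    then show ?thesis unfolding exp_add exp_of_real .
  qed
  have swap: "wave 1 t 1 u = wave 1 1 t u" for u :: real by (simp add: w mult_ac)
  have "1 + t\<^sup>2 > 0" by (simp add: add_pos_nonneg)
  then have ne: "1 + (of_real t)\<^sup>2 \<noteq> (0::complex)"
    by (metis of_real_1 of_real_add of_real_eq_0_iff of_real_power less_irrefl)
  have "csqrt v ^ (DIM(real) + 1) = v" for v
    unfolding DIM_real one_add_one by (rule power2_csqrt)
  then have f1: "(\<integral>u. wave 1 t (1::real) u \<partial>lborel) = of_real ?M / (1 + (of_real t)\<^sup>2)"
    using integral_wave[of 0 t] unfolding swap by (simp add: power2_eq_square del: csqrt_of_real_nonneg power_Suc DIM_real)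
  have f2: "(\<integral>u. of_real (u \<bullet> 1 / norm u) * wave 1 t (1::real) u \<partial>lborel) = - \<i> * of_real t * (\<integral>u. wave 1 t (1::real) u \<partial>lborel)"
    using integral_sgn_inner_wave[of 1 "1::real" t] by simp
  have f3: "(\<integral>u. of_real (u \<bullet> 1 / norm u) * wave 1 t (1::real) u \<partial>lborel) = (\<integral>u. of_real (sgn u * exp (- \<bar>u\<bar>)) * exp (- \<i> * of_real (t * u)) \<partial>lborel)"
    by (intro Bochner_Integration.integral_cong) (auto simp: w sgn_real_def)
  show ?thesis
    unfolding f3[symmetric] f2 f1 using M ne by (simp add: odd_weight_def)
qed

lemma abs_odd_weight_le_1: "\<bar>odd_weight t\<bar> \<le> 1"
proof -
  have "0 \<le> (\<bar>t\<bar> - 1)\<^sup>2" by simp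
  then have "2 * \<bar>t\<bar> \<le> 1 + t\<^sup>2" by (simp add: power2_diff)
  then have "\<bar>t\<bar> \<le> 1 + t\<^sup>2" by linarith
  moreover have "0 < 1 + t\<^sup>2" by (simp add: add_pos_nonneg)
  ultimately show ?thesis by (simp add: odd_weight_def abs_divide divide_le_eq)
qed

text \<open>
  Powers of the weight compensate the singularity \<open>\<bar>t\<bar> powr (- (d - 1) / 2)\<close> of the limiting kernel
  at the vertex of the cone.
\<close>
lemma abs_odd_weight_le_sqrt: "\<bar>odd_weight t\<bar> \<le> sqrt \<bar>t\<bar>"
proof (cases "\<bar>t\<bar> \<le> 1")
  case True
  have "\<bar>odd_weight t\<bar> \<le> \<bar>t\<bar>"
  proof -
    have "0 < 1 + t\<^sup>2" by (simp add: add_pos_nonneg)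
    moreover have "\<bar>t\<bar> * 1 \<le> \<bar>t\<bar> * (1 + t\<^sup>2)" by (intro mult_left_mono) auto
    ultimately show ?thesis by (simp add: odd_weight_def abs_divide divide_le_eq)
  qed
  also have "\<bar>t\<bar> \<le> sqrt \<bar>t\<bar>" using True mult_left_mono[of "\<bar>t\<bar>" 1 "\<bar>t\<bar>"] by (intro real_le_rsqrt) (simp add: power2_eq_square)
  finally show ?thesis .
next
  case False
  then have "1 \<le> sqrt \<bar>t\<bar>" by simp
  then show ?thesis using abs_odd_weight_le_1[of t] by linarith
qed

text \<open>Frequencies are angular here, without the factor \<open>2 * pi\<close>, to match \<open>wave\<close>.\<close>
definition weighted_transform :: "('a::euclidean_space \<times> real) measure \<Rightarrow> nat \<Rightarrow> 'a \<times> real \<Rightarrow> complex" where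
  "weighted_transform \<mu> n \<eta> = (\<integral>y. of_real (odd_weight (snd y) ^ n) * exp (- \<i> * of_real (\<eta> \<bullet> y)) \<partial>\<mu>)"

lemma norm_weighted_le_1: "norm (of_real (odd_weight t ^ n) * exp (- \<i> * of_real r)) \<le> 1"
  using abs_odd_weight_le_1[of t] by (simp add: norm_mult norm_power power_abs power_le_one)

lemma integrable_powr_exp_real:
  assumes "q \<ge> 0" shows "integrable lborel (\<lambda>u::real. (1 + \<bar>u\<bar>) powr q * exp (- \<bar>u\<bar>))"
proof (rule Bochner_Integration.integrable_bound)
  show "integrable lborel (\<lambda>u::real. 2 powr q * (norm u powr (- 0) * exp (- 1 * norm u) + norm u powr (- (- q)) * exp (- 1 * norm u)))"
    using assms by (intro integrable_mult_right Bochner_Integration.integrable_add integrable_norm_powr_exp) auto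
  show "AE u::real in lborel. norm ((1 + \<bar>u\<bar>) powr q * exp (- \<bar>u\<bar>)) \<le> norm (2 powr q * (norm u powr (- 0) * exp (- 1 * norm u) + norm u powr (- (- q)) * exp (- 1 * norm u)))"
    using AE_lborel_singleton[of "0::real"]
  proof eventually_elim
    case (elim u)
    have "(1 + \<bar>u\<bar>) powr q \<le> (2 * max 1 \<bar>u\<bar>) powr q" using assms by (intro powr_mono2) auto
    also have "\<dots> = 2 powr q * max 1 \<bar>u\<bar> powr q" by (simp add: powr_mult)
    also have "\<dots> \<le> 2 powr q * (1 + \<bar>u\<bar> powr q)" by (intro mult_left_mono) (auto simp: max_def)
    finally have "(1 + \<bar>u\<bar>) powr q * exp (- \<bar>u\<bar>) \<le> 2 powr q * (1 + \<bar>u\<bar> powr q) * exp (- \<bar>u\<bar>)"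
      by (rule mult_right_mono) simp
    then show ?case using elim by (simp add: algebra_simps)
  qed
qed measurable

text \<open>
  Multiplying by the weight averages the transform over translates in the last frequency variable
  against a multiple of \<open>sgn u * exp (- \<bar>u\<bar>)\<close>. Peetre's inequality \<open>1 + norm \<eta> \<le> (1 + norm (\<eta> + v)) * (1 + norm v)\<close>
  shows that a translate by \<open>v\<close> worsens the decay bound only by the factor \<open>(1 + norm v) powr q\<close>.
\<close>
lemma weighted_transform_decay:
  fixes \<mu> :: "('a::euclidean_space \<times> real) measure"
  assumes \<mu>: "finite_measure \<mu>" and sets[measurable_cong]: "sets \<mu> = sets borel" and q: "q \<ge> 0"
    and base: "\<And>\<eta>. norm (weighted_transform \<mu> 0 \<eta>) \<le> C * (1 + norm \<eta>) powr (- q)"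
  shows "\<exists>C. \<forall>\<eta>. norm (weighted_transform \<mu> n \<eta>) \<le> C * (1 + norm \<eta>) powr (- q)"
proof (induction n)
  case 0
  show ?case using base by blast
next
  case (Suc n)
  then obtain C where C: "\<And>\<eta>. norm (weighted_transform \<mu> n \<eta>) \<le> C * (1 + norm \<eta>) powr (- q)" by blast
  have C0: "C \<ge> 0" using order_trans[OF norm_ge_zero C[of 0]] by simp
  let ?M = "exp_mass TYPE(real)"
  let ?a = "\<lambda>u::real. of_real (sgn u * exp (- \<bar>u\<bar>)) :: complex"
  define I where "I = (\<integral>(u::real). (1 + \<bar>u\<bar>) powr q * exp (- \<bar>u\<bar>) \<partial>lborel)"
  have M: "?M > 0" by (rule exp_mass_pos)
  have int: "integrable lborel (\<lambda>u::real. (1 + \<bar>u\<bar>) powr q * exp (- \<bar>u\<bar>))" by (rule integrable_powr_exp_real[OF q])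
  have inta: "integrable lborel ?a"
    by (rule Bochner_Integration.integrable_bound[OF integrable_norm_power_exp[of 1 0]]) (auto simp: norm_mult sgn_real_def)
  have rec: "weighted_transform \<mu> (Suc n) \<eta> = \<i> / of_real ?M * (\<integral>u. ?a u * weighted_transform \<mu> n (\<eta> + (0, u)) \<partial>lborel)" for \<eta>
  proof -
    let ?b = "\<lambda>(u::real) (y::'a \<times> real). of_real (odd_weight (snd y) ^ n) * exp (- \<i> * of_real ((\<eta> + (0, u)) \<bullet> y)) :: complex"
    have "(\<integral>u. ?a u * weighted_transform \<mu> n (\<eta> + (0, u)) \<partial>lborel) = (\<integral>y. (\<integral>u. ?a u * ?b u y \<partial>lborel) \<partial>\<mu>)"
      unfolding weighted_transform_def
    proof (rule Fubini_bounded_kernel[OF \<mu> inta])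
      have eq: "(\<eta> + (0, u)) \<bullet> y = fst \<eta> \<bullet> fst y + (snd \<eta> + u) * snd y" for u and y :: "'a \<times> real"
        by (cases \<eta>; cases y) simp
      show "(\<lambda>(u, y). ?b u y) \<in> borel_measurable (lborel \<Otimes>\<^sub>M \<mu>)"
        unfolding eq by measurable
    qed (rule norm_weighted_le_1)
    also have "\<dots> = (\<integral>y. of_real (odd_weight (snd y) ^ n) * exp (- \<i> * of_real (\<eta> \<bullet> y)) * (\<integral>u. ?a u * exp (- \<i> * of_real (snd y * u)) \<partial>lborel) \<partial>\<mu>)"
    proof (intro Bochner_Integration.integral_cong refl)
      fix y :: "'a \<times> real"
      have "(\<eta> + (0, u)) \<bullet> y = \<eta> \<bullet> y + snd y * u" for u by (cases \<eta>; cases y) (simp add: algebra_simps)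
      then have "?a u * ?b u y = of_real (odd_weight (snd y) ^ n) * exp (- \<i> * of_real (\<eta> \<bullet> y)) * (?a u * exp (- \<i> * of_real (snd y * u)))" for u
        by (simp add: distrib_left exp_add[symmetric] mult_ac)
      then show "(\<integral>u. ?a u * ?b u y \<partial>lborel) = of_real (odd_weight (snd y) ^ n) * exp (- \<i> * of_real (\<eta> \<bullet> y)) * (\<integral>u. ?a u * exp (- \<i> * of_real (snd y * u)) \<partial>lborel)"
        by (simp only: integral_mult_right_zero)
    qed
    also have "\<i> / of_real ?M * \<dots> = (\<integral>y. of_real (odd_weight (snd y) ^ n) * exp (- \<i> * of_real (\<eta> \<bullet> y)) * of_real (odd_weight (snd y)) \<partial>\<mu>)"
      unfolding odd_weight_eq_integral[of "snd _"] integral_mult_right_zero[symmetric]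
      by (intro Bochner_Integration.integral_cong refl) (simp only: mult_ac)
    finally show ?thesis by (simp add: weighted_transform_def mult_ac)
  qed
  have "norm (weighted_transform \<mu> (Suc n) \<eta>) \<le> (C * I / ?M) * (1 + norm \<eta>) powr (- q)" for \<eta>
  proof -
    have pt: "norm (?a u * weighted_transform \<mu> n (\<eta> + (0, u))) \<le> (C * (1 + norm \<eta>) powr (- q)) * ((1 + \<bar>u\<bar>) powr q * exp (- \<bar>u\<bar>))" for u
    proof -
      have "norm \<eta> \<le> norm (\<eta> + (0, u)) + norm ((0::'a), u)"
        using norm_triangle_ineq4[of "\<eta> + (0, u)" "(0, u)"] by simp
      then have "1 + norm \<eta> \<le> 1 + (norm (\<eta> + (0, u)) + \<bar>u\<bar>)" by (simp add: norm_Pair)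
      also have "\<dots> \<le> (1 + norm (\<eta> + (0, u))) * (1 + \<bar>u\<bar>)" by (simp add: algebra_simps)
      finally have "(1 + norm \<eta>) powr q \<le> ((1 + norm (\<eta> + (0, u))) * (1 + \<bar>u\<bar>)) powr q"
        using q by (intro powr_mono2) auto
      also have "\<dots> = (1 + norm (\<eta> + (0, u))) powr q * (1 + \<bar>u\<bar>) powr q" by (simp add: powr_mult)
      finally have le: "(1 + norm \<eta>) powr q \<le> (1 + norm (\<eta> + (0, u))) powr q * (1 + \<bar>u\<bar>) powr q" .
      have peetre: "(1 + norm (\<eta> + (0, u))) powr (- q) \<le> (1 + norm \<eta>) powr (- q) * (1 + \<bar>u\<bar>) powr q"
      proof -
        have "inverse b \<le> inverse a * c" if "a \<le> b * c" "a > 0" "b > 0" for a b c :: real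
          using that by (simp add: field_simps)
        moreover have "1 + norm \<eta> \<noteq> 0" "1 + norm (\<eta> + (0, u)) \<noteq> 0"
          using norm_ge_zero[of \<eta>] norm_ge_zero[of "\<eta> + (0, u)"] by linarith+
        ultimately show ?thesis
          using le unfolding powr_minus by simp
      qed
      have "norm (?a u * weighted_transform \<mu> n (\<eta> + (0, u))) \<le> exp (- \<bar>u\<bar>) * (C * (1 + norm (\<eta> + (0, u))) powr (- q))"
        unfolding norm_mult by (intro mult_mono C) (auto simp: sgn_real_def)
      also have "\<dots> \<le> exp (- \<bar>u\<bar>) * (C * ((1 + norm \<eta>) powr (- q) * (1 + \<bar>u\<bar>) powr q))"
        by (intro mult_left_mono peetre C0) auto
      finally show ?thesis by (simp only: mult_ac)
    qed
    have "norm (weighted_transform \<mu> (Suc n) \<eta>) = norm (\<integral>u. ?a u * weighted_transform \<mu> n (\<eta> + (0, u)) \<partial>lborel) / ?M"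
      unfolding rec using M by (simp add: norm_mult norm_divide)
    also have "norm (\<integral>u. ?a u * weighted_transform \<mu> n (\<eta> + (0, u)) \<partial>lborel) \<le> (\<integral>u. (C * (1 + norm \<eta>) powr (- q)) * ((1 + \<bar>u\<bar>) powr q * exp (- \<bar>u\<bar>)) \<partial>lborel)"
    proof (rule order_trans[OF integral_norm_bound integral_mono'])
      show "integrable lborel (\<lambda>u. (C * (1 + norm \<eta>) powr (- q)) * ((1 + \<bar>u\<bar>) powr q * exp (- \<bar>u\<bar>)))"
        by (intro integrable_mult_right int)
      show "norm (?a u * weighted_transform \<mu> n (\<eta> + (0, u))) \<le> (C * (1 + norm \<eta>) powr (- q)) * ((1 + \<bar>u\<bar>) powr q * exp (- \<bar>u\<bar>))" for u
        by (rule pt)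
      show "0 \<le> (C * (1 + norm \<eta>) powr (- q)) * ((1 + \<bar>u\<bar>) powr q * exp (- \<bar>u\<bar>))" for u
        using C0 by simp
    qed
    also have "\<dots> = (C * (1 + norm \<eta>) powr (- q)) * I" unfolding I_def by (rule integral_mult_right_zero)
    finally show ?thesis using M by (simp add: divide_right_mono mult_ac)
  qed
  then show ?case by blast
qed

section \<open>The kernel on the cone and its limit\<close>

lemma csqrt_of_real_mult:
  assumes "k \<ge> 0" shows "csqrt (of_real k * w) = of_real (sqrt k) * csqrt w"
proof (cases "k = 0")
  case False
  with assms have "k > 0" by simp
  show ?thesis
  proof (rule csqrt_unique)
    show "(of_real (sqrt k) * csqrt w)\<^sup>2 = of_real k * w"
      using assms by (simp add: power_mult_distrib flip: of_real_power)
    show "0 < Re (of_real (sqrt k) * csqrt w) \<or> Re (of_real (sqrt k) * csqrt w) = 0 \<and> 0 \<le> Im (of_real (sqrt k) * csqrt w)"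
      using csqrt_principal[of w] \<open>k > 0\<close> by (auto simp del: csqrt.simps)
  qed
qed simp

lemma csqrt_2_i:
  assumes "t \<noteq> 0"
  shows "csqrt (2 * \<i> * of_real t) = of_real (sqrt \<bar>t\<bar>) * (if t > 0 then 1 + \<i> else 1 - \<i>)"
proof (rule csqrt_unique)
  show "(of_real (sqrt \<bar>t\<bar>) * (if t > 0 then 1 + \<i> else 1 - \<i>))\<^sup>2 = 2 * \<i> * of_real t"
  proof -
    have "(1 + \<i>)\<^sup>2 = 2 * \<i>" "(1 - \<i>)\<^sup>2 = - (2 * \<i>)" by (simp_all add: power2_eq_square algebra_simps)
    then show ?thesis using assms by (auto simp: power_mult_distrib abs_if simp flip: of_real_power)
  qed
qed (use assms in auto)

text \<open>
  The rescaled limit of the Poisson kernel at the point of the cone with last coordinate \<open>t\<close>, up to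
  the factor \<open>exp_mass\<close>. For \<open>t \<noteq> 0\<close> it is a constant multiple of
  \<open>\<bar>t\<bar> powr (- (d - 1) / 2)\<close> in absolute value, and its phase depends only on the sign of \<open>t\<close>.
\<close>
definition cone_limit :: "nat \<Rightarrow> real \<Rightarrow> complex" where
  "cone_limit d t = \<i> * of_real t / csqrt (2 * \<i> * of_real t) ^ (d + 1)"

text \<open>
  On the cone the quadratic terms of the discriminant cancel, so that it grows only linearly in
  \<open>k\<close>; this is why the kernel decays no faster than \<open>k powr (- (d - 1) / 2)\<close> there.
\<close>
lemma integral_wave_cone:
  fixes x :: "'a::euclidean_space"
  assumes cone: "norm x = \<bar>t\<bar>" and k: "k > 0" and t: "t \<noteq> 0"
  shows "of_real (sqrt k ^ (DIM('a) - 1)) * (\<integral>\<xi>. wave (1 + \<i> * of_real (k * t)) 1 (k *\<^sub>R x) \<xi> \<partial>lborel)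
    = of_real (exp_mass TYPE('a)) * ((of_real (1 / k) + \<i> * of_real t) / csqrt (of_real (1 / k) + 2 * \<i> * of_real t) ^ (DIM('a) + 1))"
proof -
  let ?w = "of_real (1 / k) + 2 * \<i> * of_real t :: complex"
  obtain m where m: "DIM('a) = Suc m" using DIM_positive[where 'a='a] gr0_conv_Suc by blast
  have w0: "?w \<noteq> 0" using t by (auto simp: complex_eq_iff)
  have "x \<bullet> x = t\<^sup>2" using cone by (simp add: dot_square_norm)
  then have "(1 + \<i> * of_real (k * t))\<^sup>2 + of_real ((k *\<^sub>R x) \<bullet> (k *\<^sub>R x)) = of_real k * ?w"
    using k by (simp add: power2_eq_square algebra_simps)
  then have "(\<integral>\<xi>. wave (1 + \<i> * of_real (k * t)) 1 (k *\<^sub>R x) \<xi> \<partial>lborel)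
    = of_real (exp_mass TYPE('a)) * (1 + \<i> * of_real (k * t)) / (of_real (sqrt k) * csqrt ?w) ^ (DIM('a) + 1)"
    unfolding integral_wave using k by (simp only: csqrt_of_real_mult less_imp_le)
  moreover have "1 + \<i> * of_real (k * t) = of_real (sqrt k) * of_real (sqrt k) * (of_real (1/k) + \<i> * of_real t)"
    using k by (simp add: algebra_simps flip: of_real_mult)
  moreover have "S ^ j * (M * (S * S * u) / (S * c) ^ (j + 1 + 1)) = M * (u / c ^ (j + 1 + 1))" if "S \<noteq> 0" "c \<noteq> 0" for S M u c :: complex and j
    using that by (simp add: power_mult_distrib field_simps)
  from this[of "of_real (sqrt k)" "csqrt ?w" m] have "of_real (sqrt k) ^ m * (of_real (exp_mass TYPE('a)) * (of_real (sqrt k) * of_real (sqrt k) * (of_real (1 / k) + \<i> * of_real t)) / (of_real (sqrt k) * csqrt ?w) ^ (m + 1 + 1))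
      = of_real (exp_mass TYPE('a)) * ((of_real (1 / k) + \<i> * of_real t) / csqrt ?w ^ (m + 1 + 1))"
    using k w0 by (simp del: csqrt.simps)
  ultimately show ?thesis
    by (simp only: m add_diff_cancel_right' Suc_eq_plus1 of_real_power)
qed

lemma cone_kernel_tendsto:
  assumes t: "t \<noteq> 0"
  shows "(\<lambda>k. (of_real (1 / real (Suc k)) + \<i> * of_real t) / csqrt (of_real (1 / real (Suc k)) + 2 * \<i> * of_real t) ^ (d + 1)) \<longlonglongrightarrow> cone_limit d t"
proof -
  have l: "(\<lambda>k. complex_of_real (1 / real (Suc k))) \<longlonglongrightarrow> of_real 0"
    by (intro tendsto_of_real LIMSEQ_Suc lim_1_over_n)
  have "isCont csqrt (of_real 0 + 2 * \<i> * of_real t)"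
    using t by (intro continuous_at_csqrt) (auto simp: complex_nonpos_Reals_iff)
  then have "(\<lambda>k. csqrt (of_real (1 / real (Suc k)) + 2 * \<i> * of_real t)) \<longlonglongrightarrow> csqrt (of_real 0 + 2 * \<i> * of_real t)"
    by (rule isCont_tendsto_compose) (intro tendsto_intros l)
  moreover have "csqrt (of_real 0 + 2 * \<i> * of_real t) \<noteq> 0" using t by simp
  ultimately have "(\<lambda>k. (of_real (1 / real (Suc k)) + \<i> * of_real t) / csqrt (of_real (1 / real (Suc k)) + 2 * \<i> * of_real t) ^ (d + 1))
     \<longlonglongrightarrow> (of_real 0 + \<i> * of_real t) / csqrt (of_real 0 + 2 * \<i> * of_real t) ^ (d + 1)"
    by (intro tendsto_intros l) auto
  then show ?thesis by (simp add: cone_limit_def)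
qed

lemma cone_kernel_bound:
  assumes t: "t \<noteq> 0" and k: "e \<ge> 0" and n: "n \<ge> m"
  shows "norm (of_real (odd_weight t ^ n) * ((of_real e + \<i> * of_real t) / csqrt (of_real e + 2 * \<i> * of_real t) ^ (m + 2))) \<le> 1"
proof -
  let ?w = "of_real e + 2 * \<i> * of_real t :: complex"
  have w1: "norm (of_real e + \<i> * of_real t) \<le> norm ?w"
    unfolding cmod_def using k by (intro real_sqrt_le_mono) (simp add: power_mult_distrib)
  have w2: "\<bar>t\<bar> \<le> norm ?w" using abs_Im_le_cmod[of ?w] by simp
  have w0: "norm ?w > 0" using w2 t by linarith
  have "norm ((of_real e + \<i> * of_real t) / csqrt ?w ^ (m + 2)) \<le> norm ?w / sqrt (norm ?w) ^ (m + 2)"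
    unfolding norm_divide norm_power norm_csqrt using w1 by (intro divide_right_mono) auto
  also have "\<dots> = 1 / sqrt (norm ?w) ^ m" unfolding power_add using w0 by simp
  also have "\<dots> \<le> 1 / sqrt \<bar>t\<bar> ^ m"
    using t w2 w0 by (intro divide_left_mono power_mono mult_pos_pos zero_less_power) auto
  finally have 1: "norm ((of_real e + \<i> * of_real t) / csqrt ?w ^ (m + 2)) \<le> 1 / sqrt \<bar>t\<bar> ^ m" .
  have "\<bar>odd_weight t\<bar> ^ n \<le> \<bar>odd_weight t\<bar> ^ m"
    using n abs_odd_weight_le_1 by (intro power_decreasing) auto
  also have "\<dots> \<le> sqrt \<bar>t\<bar> ^ m" by (intro power_mono abs_odd_weight_le_sqrt) auto
  finally have 2: "\<bar>odd_weight t\<bar> ^ n \<le> sqrt \<bar>t\<bar> ^ m" .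
  have "norm (of_real (odd_weight t ^ n) * ((of_real e + \<i> * of_real t) / csqrt ?w ^ (m + 2))) \<le> sqrt \<bar>t\<bar> ^ m * (1 / sqrt \<bar>t\<bar> ^ m)"
    unfolding norm_mult[of "of_real (odd_weight t ^ n)"] norm_of_real power_abs by (intro mult_mono 1 2) auto
  then show ?thesis using t by simp
qed

text \<open>
  The phases of the limit on the two halves of the cone are complex conjugates of each other, so
  they may cancel in an integral. An even power of the weight keeps the real parts equal in sign, an
  odd power the imaginary parts, and at least one of the two parts is nonzero.
\<close>
lemma cone_limit_sign:
  "\<exists>n\<ge>m + 1. \<exists>c. \<forall>t. t \<noteq> 0 \<longrightarrow> Re (c * (of_real (odd_weight t ^ n) * cone_limit (m + 1) t)) > 0"
proof -
  define \<kappa> where "\<kappa> = 1 / (1 + \<i>) ^ m"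
  have cnj\<kappa>: "cnj \<kappa> = 1 / (1 - \<i>) ^ m" by (simp add: \<kappa>_def)
  have "1 + \<i> \<noteq> 0" by (simp add: complex_eq_iff)
  then have \<kappa>0: "\<kappa> \<noteq> 0" by (simp add: \<kappa>_def)
  have L: "cone_limit (m + 1) t = of_real (1 / (2 * sqrt \<bar>t\<bar> ^ m)) * (if t > 0 then \<kappa> else cnj \<kappa>)" if "t \<noteq> 0" for t
  proof -
    have "cone_limit (m + 1) t = 1 / (2 * csqrt (2 * \<i> * of_real t) ^ m)"
    proof -
      have "csqrt (2 * \<i> * of_real t) ^ (m + 1 + 1) = csqrt (2 * \<i> * of_real t) ^ m * (csqrt (2 * \<i> * of_real t))\<^sup>2"
        by (simp only: power_add[symmetric] add.assoc one_add_one)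
      also have "(csqrt (2 * \<i> * of_real t))\<^sup>2 = 2 * \<i> * of_real t" by (rule power2_csqrt)
      finally show ?thesis using that by (simp add: cone_limit_def field_simps)
    qed
    then show ?thesis
      unfolding csqrt_2_i[OF that] by (auto simp: power_mult_distrib cnj\<kappa> \<kappa>_def)
  qed
  have w: "odd_weight t / t > 0" if "t \<noteq> 0" for t
    using that by (simp add: odd_weight_def add_pos_nonneg)
  have ev: "odd_weight t ^ n > 0" if "t \<noteq> 0" "even n" for t n
    using w[OF that(1)] that by (auto simp: zero_less_power_eq)
  have od: "odd_weight t ^ n * sgn t > 0" if "t \<noteq> 0" "odd n" for t n
    using w[OF that(1)] that by (cases "t > 0") (auto simp: zero_less_divide_iff odd_power_less_zero)
  show ?thesis
  proof (cases "Re \<kappa> = 0")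
    case False
    have "Re (of_real (Re \<kappa>) * (of_real (odd_weight t ^ (2 * (m + 1))) * cone_limit (m + 1) t)) > 0" if "t \<noteq> 0" for t
    proof -
      have "Re (of_real (Re \<kappa>) * (of_real (odd_weight t ^ (2 * (m + 1))) * cone_limit (m + 1) t))
         = (Re \<kappa> * Re \<kappa>) * (odd_weight t ^ (2 * (m + 1)) * (1 / (2 * sqrt \<bar>t\<bar> ^ m)))"
        unfolding L[OF that] by (simp add: Re_complex_of_real flip: of_real_power)
      also have "\<dots> > 0"
      proof (rule mult_pos_pos[OF _ mult_pos_pos])
        show "Re \<kappa> * Re \<kappa> > 0" using False not_real_square_gt_zero[of "Re \<kappa>"] by blast
        show "odd_weight t ^ (2 * (m + 1)) > 0" by (rule ev[OF that]) simp
      qed (use that in simp)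
      finally show ?thesis .
    qed
    moreover have "m + 1 \<le> 2 * (m + 1)" by simp
    ultimately show ?thesis by blast
  next
    case True
    with \<kappa>0 have im: "Im \<kappa> \<noteq> 0" by (auto simp: complex_eq_iff)
    have "Re (- \<i> * of_real (Im \<kappa>) * (of_real (odd_weight t ^ (2 * m + 1)) * cone_limit (m + 1) t)) > 0" if "t \<noteq> 0" for t
    proof -
      have "Re (- \<i> * of_real (Im \<kappa>) * (of_real (odd_weight t ^ (2 * m + 1)) * cone_limit (m + 1) t))
         = (Im \<kappa> * Im \<kappa>) * ((odd_weight t ^ (2 * m + 1) * sgn t) * (1 / (2 * sqrt \<bar>t\<bar> ^ m)))"
        unfolding L[OF that] using that by (auto simp: sgn_real_def simp flip: of_real_power)
      also have "\<dots> > 0"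
      proof (rule mult_pos_pos[OF _ mult_pos_pos])
        show "Im \<kappa> * Im \<kappa> > 0" using im not_real_square_gt_zero[of "Im \<kappa>"] by blast
        show "odd_weight t ^ (2 * m + 1) * sgn t > 0" by (rule od[OF that]) simp
      qed (use that in simp)
      finally show ?thesis .
    qed
    moreover have "m + 1 \<le> 2 * m + 1" by simp
    ultimately show ?thesis by blast
  qed
qed

section \<open>Averaging a transform over the light cone\<close>

text \<open>
  Duality: averaging the transform of a measure over dilates of the cone in frequency space
  integrates the Poisson kernel against that measure.
\<close>
lemma weighted_transform_cone_average:
  fixes \<mu> :: "('a::euclidean_space \<times> real) measure"
  assumes \<mu>: "finite_measure \<mu>" and sets[measurable_cong]: "sets \<mu> = sets borel"
  shows "(\<integral>\<xi>. of_real (exp (- norm \<xi>)) * weighted_transform \<mu> n (k *\<^sub>R (\<xi>, norm \<xi>)) \<partial>lborel) =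
    (\<integral>y. of_real (odd_weight (snd y) ^ n) * (\<integral>\<xi>. wave (1 + \<i> * of_real (k * snd y)) 1 (k *\<^sub>R fst y) \<xi> \<partial>lborel) \<partial>\<mu>)"
proof -
  let ?b = "\<lambda>(\<xi>::'a) (y::'a \<times> real). of_real (odd_weight (snd y) ^ n) * exp (- \<i> * of_real (k *\<^sub>R (\<xi>, norm \<xi>) \<bullet> y)) :: complex"
  have eq: "k *\<^sub>R (\<xi>, norm \<xi>) \<bullet> y = k * (\<xi> \<bullet> fst y + norm \<xi> * snd y)" for \<xi> and y :: "'a \<times> real"
    by (cases y) (simp add: algebra_simps)
  have "integrable lborel (\<lambda>\<xi>::'a. exp (- norm \<xi>))"
    using integrable_norm_power_exp[of 1 0] by simp
  then have int: "integrable lborel (\<lambda>\<xi>::'a. complex_of_real (exp (- norm \<xi>)))"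
    by (simp only: integrable_of_real)
  have "(\<integral>\<xi>. of_real (exp (- norm \<xi>)) * weighted_transform \<mu> n (k *\<^sub>R (\<xi>, norm \<xi>)) \<partial>lborel)
     = (\<integral>y. (\<integral>\<xi>. of_real (exp (- norm \<xi>)) * ?b \<xi> y \<partial>lborel) \<partial>\<mu>)"
    unfolding weighted_transform_def
  proof (rule Fubini_bounded_kernel[OF \<mu> int])
    show "(\<lambda>(\<xi>, y). ?b \<xi> y) \<in> borel_measurable (lborel \<Otimes>\<^sub>M \<mu>)"
      unfolding eq by measurable
  qed (rule norm_weighted_le_1)
  also have "\<dots> = (\<integral>y. of_real (odd_weight (snd y) ^ n) * (\<integral>\<xi>. wave (1 + \<i> * of_real (k * snd y)) 1 (k *\<^sub>R fst y) \<xi> \<partial>lborel) \<partial>\<mu>)"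
  proof (intro Bochner_Integration.integral_cong refl)
    fix y :: "'a \<times> real"
    have "wave (1 + \<i> * of_real (k * snd y)) 1 (k *\<^sub>R fst y) \<xi> = of_real (exp (- norm \<xi>)) * exp (- \<i> * of_real (k *\<^sub>R (\<xi>, norm \<xi>) \<bullet> y))" for \<xi>
    proof -
      have "wave (1 + \<i> * of_real (k * snd y)) 1 (k *\<^sub>R fst y) \<xi> = exp (of_real (- norm \<xi>) + - \<i> * of_real (k *\<^sub>R (\<xi>, norm \<xi>) \<bullet> y))"
        unfolding eq by (simp add: wave_def algebra_simps)
      then show ?thesis unfolding exp_add exp_of_real .
    qed
    then have "of_real (exp (- norm \<xi>)) * ?b \<xi> y = of_real (odd_weight (snd y) ^ n) * wave (1 + \<i> * of_real (k * snd y)) 1 (k *\<^sub>R fst y) \<xi>" for \<xi>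
      by (simp only: mult_ac)
    then show "(\<integral>\<xi>. of_real (exp (- norm \<xi>)) * ?b \<xi> y \<partial>lborel) = of_real (odd_weight (snd y) ^ n) * (\<integral>\<xi>. wave (1 + \<i> * of_real (k * snd y)) 1 (k *\<^sub>R fst y) \<xi> \<partial>lborel)"
      by (simp only: integral_mult_right_zero)
  qed
  finally show ?thesis .
qed

text \<open>
  Inserting the decay bound leaves the integral of \<open>norm \<xi> powr (- q) * exp (- norm \<xi>)\<close>, which
  converges at the origin once \<open>q\<close> has been lowered below the dimension; there is room above
  \<open>(DIM('a) - 1) / 2\<close> for that.
\<close>
lemma cone_average_decay:
  fixes W :: "'a::euclidean_space \<times> real \<Rightarrow> complex"
  assumes W: "\<And>\<eta>. norm (W \<eta>) \<le> C * (1 + norm \<eta>) powr (- q)" and q: "q > (real DIM('a) - 1) / 2"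
  shows "(\<lambda>k. of_real (sqrt (real (Suc k)) ^ (DIM('a) - 1)) * (\<integral>\<xi>. of_real (exp (- norm \<xi>)) * W (real (Suc k) *\<^sub>R (\<xi>, norm \<xi>)) \<partial>lborel)) \<longlonglongrightarrow> 0"
proof -
  let ?p = "(real DIM('a) - 1) / 2"
  \<comment> \<open>Any number strictly between \<open>0\<close> and \<open>1\<close> could replace \<open>1/4\<close>: below \<open>1\<close>, \<open>?p < q'\<close> holds in dimension one as well.\<close>
  define q' where "q' = min q (real DIM('a) - 1/4)"
  have D1: "real DIM('a) \<ge> 1" using DIM_positive[where 'a='a] by linarith
  have q': "?p < q'" "q' \<le> q" "q' < real DIM('a)" using q D1 unfolding q'_def min_def by (simp_all split: if_split; linarith)+
  moreover have "?p \<ge> 0" using D1 by simp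
  ultimately have q'0: "q' > 0" by linarith
  have C0: "C \<ge> 0" using order_trans[OF norm_ge_zero W[of 0]] by simp
  define I where "I = (\<integral>\<xi>. norm (\<xi>::'a) powr (- q') * exp (- 1 * norm \<xi>) \<partial>lborel)"
  have int: "integrable lborel (\<lambda>\<xi>::'a. norm \<xi> powr (- q') * exp (- 1 * norm \<xi>))"
    using q' by (intro integrable_norm_powr_exp) auto
  have bound: "norm (\<integral>\<xi>. of_real (exp (- norm \<xi>)) * W (k *\<^sub>R (\<xi>, norm \<xi>)) \<partial>lborel) \<le> C * k powr (- q') * I" if k: "k > 0" for k
  proof -
    have pt: "norm (of_real (exp (- norm \<xi>)) * W (k *\<^sub>R (\<xi>, norm \<xi>))) \<le> (C * k powr (- q')) * (norm \<xi> powr (- q') * exp (- 1 * norm \<xi>))"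
      if "\<xi> \<noteq> 0" for \<xi> :: 'a
    proof -
      have n: "norm \<xi> > 0" using that by simp
      have "norm \<xi> \<le> norm (\<xi>, norm \<xi>)" using norm_fst_le[of \<xi> "norm \<xi>"] by simp
      then have le: "k * norm \<xi> \<le> norm (k *\<^sub>R (\<xi>, norm \<xi>))" using k by (simp del: scaleR_Pair)
      have "(1 + norm (k *\<^sub>R (\<xi>, norm \<xi>))) powr (- q) \<le> (1 + norm (k *\<^sub>R (\<xi>, norm \<xi>))) powr (- q')"
        using q' by (intro powr_mono) auto
      also have "\<dots> \<le> (k * norm \<xi>) powr (- q')"
        using le k n q'0 by (intro powr_mono2') auto
      also have "\<dots> = k powr (- q') * norm \<xi> powr (- q')" using k by (simp add: powr_mult)
      finally have "C * (1 + norm (k *\<^sub>R (\<xi>, norm \<xi>))) powr (- q) \<le> C * (k powr (- q') * norm \<xi> powr (- q'))"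
        using C0 by (rule mult_left_mono)
      then have "exp (- norm \<xi>) * norm (W (k *\<^sub>R (\<xi>, norm \<xi>))) \<le> exp (- norm \<xi>) * (C * (k powr (- q') * norm \<xi> powr (- q')))"
        using W[of "k *\<^sub>R (\<xi>, norm \<xi>)"] by (intro mult_left_mono) (linarith, simp)
      then show ?thesis by (simp add: norm_mult mult_ac)
    qed
    have "norm (\<integral>\<xi>. of_real (exp (- norm \<xi>)) * W (k *\<^sub>R (\<xi>, norm \<xi>)) \<partial>lborel) \<le> (\<integral>\<xi>. norm (of_real (exp (- norm \<xi>)) * W (k *\<^sub>R (\<xi>, norm \<xi>))) \<partial>lborel)"
      by (rule integral_norm_bound)
    also have "\<dots> \<le> (\<integral>\<xi>. (C * k powr (- q')) * (norm (\<xi>::'a) powr (- q') * exp (- 1 * norm \<xi>)) \<partial>lborel)"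
    proof (rule integral_mono_AE')
      show "integrable lborel (\<lambda>\<xi>. (C * k powr (- q')) * (norm (\<xi>::'a) powr (- q') * exp (- 1 * norm \<xi>)))"
        by (intro integrable_mult_right int)
      show "AE \<xi> in lborel. norm (of_real (exp (- norm \<xi>)) * W (k *\<^sub>R (\<xi>, norm \<xi>))) \<le> (C * k powr (- q')) * (norm (\<xi>::'a) powr (- q') * exp (- 1 * norm \<xi>))"
        using AE_lborel_singleton[of "0::'a"] by eventually_elim (rule pt)
      show "AE \<xi> in lborel. 0 \<le> (C * k powr (- q')) * (norm (\<xi>::'a) powr (- q') * exp (- 1 * norm \<xi>))" using C0 by simp
    qed
    also have "\<dots> = C * k powr (- q') * I" unfolding I_def by (rule integral_mult_right_zero)
    finally show ?thesis .
  qed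
  have "(\<lambda>k. C * I * real (Suc k) powr (- (q' - ?p))) \<longlonglongrightarrow> C * I * 0"
    using q' by (intro tendsto_mult tendsto_const LIMSEQ_Suc tendsto_neg_powr filterlim_real_sequentially) auto
  then have "(\<lambda>k. C * I * real (Suc k) powr (- (q' - ?p))) \<longlonglongrightarrow> 0" by (simp only: mult_zero_right)
  then show ?thesis
  proof (rule Lim_null_comparison[rotated])
    show "\<forall>\<^sub>F k in sequentially. norm (of_real (sqrt (real (Suc k)) ^ (DIM('a) - 1)) * (\<integral>\<xi>. of_real (exp (- norm \<xi>)) * W (real (Suc k) *\<^sub>R (\<xi>, norm \<xi>)) \<partial>lborel))
       \<le> C * I * real (Suc k) powr (- (q' - ?p))"
    proof (intro always_eventually allI)
      fix k
      let ?k = "real (Suc k)"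
      have k: "?k > 0" by simp
      have s: "sqrt ?k ^ (DIM('a) - 1) = ?k powr ?p"
        using k D1 by (simp add: powr_half_sqrt[symmetric] powr_powr of_nat_diff DIM_positive Suc_leI del: of_nat_Suc One_nat_def flip: powr_realpow)
      have "norm (of_real (sqrt ?k ^ (DIM('a) - 1)) * (\<integral>\<xi>. of_real (exp (- norm \<xi>)) * W (?k *\<^sub>R (\<xi>, norm \<xi>)) \<partial>lborel))
         \<le> ?k powr ?p * (C * ?k powr (- q') * I)"
        unfolding s norm_mult norm_of_real by (intro mult_mono bound k) auto
      also have "\<dots> = C * I * ?k powr (- (q' - ?p))"
      proof -
        have "?k powr (- (q' - ?p)) = ?k powr ?p * ?k powr (- q')" unfolding powr_add[symmetric] by simp
        then show ?thesis by (simp only: mult_ac)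
      qed
      finally show "norm (of_real (sqrt ?k ^ (DIM('a) - 1)) * (\<integral>\<xi>. of_real (exp (- norm \<xi>)) * W (?k *\<^sub>R (\<xi>, norm \<xi>)) \<partial>lborel))
         \<le> C * I * ?k powr (- (q' - ?p))" .
    qed
  qed
qed

text \<open>
  For a measure carried by the cone the same average can be computed: the rescaled kernels converge
  pointwise, and thanks to the weight they are bounded by a constant.
\<close>
lemma cone_average_limit:
  fixes \<mu> :: "('a::euclidean_space \<times> real) measure"
  assumes \<mu>: "finite_measure \<mu>" and sets[measurable_cong]: "sets \<mu> = sets borel"
    and cone: "AE y in \<mu>. norm (fst y) = \<bar>snd y\<bar>" and n: "n \<ge> DIM('a)"
  shows "(\<lambda>k. of_real (sqrt (real (Suc k)) ^ (DIM('a) - 1)) * (\<integral>\<xi>. of_real (exp (- norm \<xi>)) * weighted_transform \<mu> n (real (Suc k) *\<^sub>R (\<xi>, norm \<xi>)) \<partial>lborel))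
     \<longlonglongrightarrow> of_real (exp_mass TYPE('a)) * (\<integral>y. of_real (odd_weight (snd y) ^ n) * cone_limit DIM('a) (snd y) \<partial>\<mu>)"
    and "integrable \<mu> (\<lambda>y. of_real (odd_weight (snd y) ^ n) * cone_limit DIM('a) (snd y))"
proof -
  interpret finite_measure \<mu> by fact
  obtain m where m: "DIM('a) = Suc m" using DIM_positive[where 'a='a] gr0_conv_Suc by blast
  let ?M = "complex_of_real (exp_mass TYPE('a))"
  let ?g = "\<lambda>e t. (of_real e + \<i> * of_real t) / csqrt (of_real e + 2 * \<i> * of_real t) ^ (DIM('a) + 1)"
  have n0: "n > 0" using n DIM_positive[where 'a='a] by linarith
  have [measurable]: "csqrt \<in> borel_measurable borel"
    by (subst borel_measurable_complex_iff) simp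
  have lim: "(\<lambda>k. of_real (odd_weight t ^ n) * ?g (1 / real (Suc k)) t) \<longlonglongrightarrow> of_real (odd_weight t ^ n) * cone_limit DIM('a) t" for t
  proof (cases "t = 0")
    case True
    then show ?thesis using n0 by (simp add: odd_weight_def power_0_left)
  next
    case False
    then show ?thesis by (intro tendsto_mult tendsto_const cone_kernel_tendsto)
  qed
  have bd: "norm (of_real (odd_weight t ^ n) * ?g (1 / real (Suc k)) t) \<le> 1" for k t
  proof (cases "t = 0")
    case True
    then show ?thesis using n0 by (simp add: odd_weight_def power_0_left)
  next
    case False
    then show ?thesis using cone_kernel_bound[of t "1 / real (Suc k)" m n] n by (simp add: m)
  qed
  have meas: "(\<lambda>y. of_real (odd_weight (snd y) ^ n) * cone_limit DIM('a) (snd y)) \<in> borel_measurable \<mu>"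
    "(\<lambda>y. of_real (odd_weight (snd y) ^ n) * ?g (1 / real (Suc k)) (snd y)) \<in> borel_measurable \<mu>" for k
    unfolding cone_limit_def by measurable
  show "integrable \<mu> (\<lambda>y. of_real (odd_weight (snd y) ^ n) * cone_limit DIM('a) (snd y))"
    by (rule integrable_dominated_convergence[where s="\<lambda>k y. of_real (odd_weight (snd y) ^ n) * ?g (1 / real (Suc k)) (snd y)" and w="\<lambda>_. 1"]) (rule meas, rule meas, simp, rule AE_I2, rule lim, rule AE_I2, rule bd)
  have "(\<lambda>k. \<integral>y. of_real (odd_weight (snd y) ^ n) * ?g (1 / real (Suc k)) (snd y) \<partial>\<mu>)
     \<longlonglongrightarrow> (\<integral>y. of_real (odd_weight (snd y) ^ n) * cone_limit DIM('a) (snd y) \<partial>\<mu>)"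
    by (rule integral_dominated_convergence[where s="\<lambda>k y. of_real (odd_weight (snd y) ^ n) * ?g (1 / real (Suc k)) (snd y)" and w="\<lambda>_. 1"]) (rule meas, rule meas, simp, rule AE_I2, rule lim, rule AE_I2, rule bd)
  then have L: "(\<lambda>k. ?M * (\<integral>y. of_real (odd_weight (snd y) ^ n) * ?g (1 / real (Suc k)) (snd y) \<partial>\<mu>))
     \<longlonglongrightarrow> ?M * (\<integral>y. of_real (odd_weight (snd y) ^ n) * cone_limit DIM('a) (snd y) \<partial>\<mu>)"
    by (intro tendsto_mult tendsto_const)
  have scaled: "?M * (\<integral>y. of_real (odd_weight (snd y) ^ n) * ?g (1 / k) (snd y) \<partial>\<mu>)
    = of_real (sqrt k ^ (DIM('a) - 1)) * (\<integral>\<xi>. of_real (exp (- norm \<xi>)) * weighted_transform \<mu> n (k *\<^sub>R (\<xi>, norm \<xi>)) \<partial>lborel)"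
    if k: "k > 0" for k
  proof -
    have "?M * (\<integral>y. of_real (odd_weight (snd y) ^ n) * ?g (1 / k) (snd y) \<partial>\<mu>)
      = (\<integral>y. ?M * (of_real (odd_weight (snd y) ^ n) * ?g (1 / k) (snd y)) \<partial>\<mu>)"
      by (rule integral_mult_right_zero[symmetric])
    also have "\<dots> = (\<integral>y. of_real (sqrt k ^ (DIM('a) - 1)) * (of_real (odd_weight (snd y) ^ n) * (\<integral>\<xi>. wave (1 + \<i> * of_real (k * snd y)) 1 (k *\<^sub>R fst y) \<xi> \<partial>lborel)) \<partial>\<mu>)"
    proof (rule integral_cong_AE)
    show "AE y in \<mu>. ?M * (of_real (odd_weight (snd y) ^ n) * ?g (1 / k) (snd y)) =
      of_real (sqrt k ^ (DIM('a) - 1)) * (of_real (odd_weight (snd y) ^ n) * (\<integral>\<xi>. wave (1 + \<i> * of_real (k * snd y)) 1 (k *\<^sub>R fst y) \<xi> \<partial>lborel))"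
      using cone
    proof eventually_elim
      case (elim y)
      show ?case
      proof (cases "snd y = 0")
        case True
        then show ?thesis using n0 by (simp add: odd_weight_def power_0_left)
      next
        case False
        show ?thesis
          using integral_wave_cone[OF elim k False] by (simp only: mult_ac)
      qed
    qed
    show "(\<lambda>y. of_real (sqrt k ^ (DIM('a) - 1)) * (of_real (odd_weight (snd y) ^ n) * (\<integral>\<xi>. wave (1 + \<i> * of_real (k * snd y)) 1 (k *\<^sub>R fst y) \<xi> \<partial>lborel))) \<in> borel_measurable \<mu>"
      unfolding integral_wave by measurable
    qed measurable
    also have "\<dots> = of_real (sqrt k ^ (DIM('a) - 1)) * (\<integral>y. of_real (odd_weight (snd y) ^ n) * (\<integral>\<xi>. wave (1 + \<i> * of_real (k * snd y)) 1 (k *\<^sub>R fst y) \<xi> \<partial>lborel) \<partial>\<mu>)"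
      by (rule integral_mult_right_zero)
    finally show ?thesis unfolding weighted_transform_cone_average[OF \<mu> sets] .
  qed
  show "(\<lambda>k. of_real (sqrt (real (Suc k)) ^ (DIM('a) - 1)) * (\<integral>\<xi>. of_real (exp (- norm \<xi>)) * weighted_transform \<mu> n (real (Suc k) *\<^sub>R (\<xi>, norm \<xi>)) \<partial>lborel))
     \<longlonglongrightarrow> ?M * (\<integral>y. of_real (odd_weight (snd y) ^ n) * cone_limit DIM('a) (snd y) \<partial>\<mu>)"
    using L by (simp only: scaled of_nat_0_less_iff zero_less_Suc)
qed

section \<open>The Fourier dimension of the cone\<close>

lemma weighted_transform_0_eq_fourier_measure:
  "weighted_transform \<mu> 0 \<eta> = fourier_measure \<mu> ((1 / (2 * pi)) *\<^sub>R \<eta>)"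
  unfolding weighted_transform_def fourier_measure_def
  by (intro Bochner_Integration.integral_cong) (auto simp: field_simps)

text \<open>
  If the decay exponent were larger, the rescaled averages would tend to \<open>0\<close>, whereas their limit is the
  integral of a function with positive real part (after multiplication by a constant) wherever
  \<open>t \<noteq> 0\<close>. So the measure would be a point mass at the vertex, whose transform does not decay.
\<close>
lemma fourier_decay_cone_le:
  assumes "fourier_decay {(x::'a::euclidean_space, t::real). norm x = \<bar>t\<bar>} s"
  shows "s \<le> real DIM('a) - 1"
proof (rule ccontr)
  assume "\<not> s \<le> real DIM('a) - 1"
  then have s: "s > real DIM('a) - 1" by simp
  obtain m where m: "DIM('a) = Suc m" using DIM_positive[where 'a='a] gr0_conv_Suc by blast
  from s have s0: "s > 0" by (simp add: m)
  define q where "q = s / 2"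
  have q: "q > 0" "q > (real DIM('a) - 1) / 2" using s s0 by (auto simp: q_def)
  from assms obtain \<mu> :: "('a \<times> real) measure" and C where sets[measurable_cong]: "sets \<mu> = sets borel"
    and prob: "prob_space \<mu>" and supp: "AE y in \<mu>. y \<in> {(x, t). norm x = \<bar>t\<bar>}" and C: "C > 0"
    and decay: "\<And>\<xi>. \<xi> \<noteq> 0 \<Longrightarrow> norm (fourier_measure \<mu> \<xi>) \<le> C * norm \<xi> powr (- s / 2)"
    unfolding fourier_decay_def by blast
  interpret prob_space \<mu> by fact
  from supp have cone: "AE y in \<mu>. norm (fst y) = \<bar>snd y\<bar>" by eventually_elim (auto simp: case_prod_beta)
  have fin: "finite_measure \<mu>" by (rule finite_measure_axioms)
  \<comment> \<open>The bound for nonzero frequencies, made uniform near \<open>0\<close> and rescaled from \<open>2 * pi * \<xi>\<close> to \<open>\<eta>\<close>.\<close>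
  have base: "norm (weighted_transform \<mu> 0 \<eta>) \<le> (2 powr q + C * (4 * pi) powr q) * (1 + norm \<eta>) powr (- q)" for \<eta>
  proof (cases "norm \<eta> \<le> 1")
    case True
    have "norm (weighted_transform \<mu> 0 \<eta>) \<le> (\<integral>y. norm (of_real (odd_weight (snd y) ^ 0) * exp (- \<i> * of_real (\<eta> \<bullet> y))) \<partial>\<mu>)"
      unfolding weighted_transform_def by (rule integral_norm_bound)
    also have "\<dots> = 1" by (simp add: prob_space)
    also have "1 = 2 powr q * 2 powr (- q)" by (simp add: powr_minus)
    also have "\<dots> \<le> (2 powr q + C * (4 * pi) powr q) * (1 + norm \<eta>) powr (- q)"
      using True q C norm_ge_zero[of \<eta>] by (intro mult_mono powr_mono2') (auto intro: add_nonneg_nonneg add_pos_nonneg)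
    finally show ?thesis .
  next
    case False
    then have nz: "(1 / (2 * pi)) *\<^sub>R \<eta> \<noteq> 0" by auto
    have "norm (weighted_transform \<mu> 0 \<eta>) \<le> C * norm ((1 / (2 * pi)) *\<^sub>R \<eta>) powr (- q)"
      using decay[OF nz] by (simp add: weighted_transform_0_eq_fourier_measure q_def)
    also have "\<dots> \<le> C * ((1 / (4 * pi)) * (1 + norm \<eta>)) powr (- q)"
      using False C q by (intro mult_left_mono powr_mono2') (auto simp: field_simps)
    also have "\<dots> = C * (4 * pi) powr q * (1 + norm \<eta>) powr (- q)"
      by (subst powr_mult) (auto simp: powr_minus powr_divide field_simps)
    also have "\<dots> \<le> (2 powr q + C * (4 * pi) powr q) * (1 + norm \<eta>) powr (- q)"
      by (intro mult_right_mono) auto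
    finally show ?thesis .
  qed
  obtain n c where n: "n \<ge> m + 1" and sgn: "\<And>t. t \<noteq> 0 \<Longrightarrow> Re (c * (of_real (odd_weight t ^ n) * cone_limit (m + 1) t)) > 0"
    using cone_limit_sign[of m] by blast
  obtain C' where C': "\<And>\<eta>. norm (weighted_transform \<mu> n \<eta>) \<le> C' * (1 + norm \<eta>) powr (- q)"
    using weighted_transform_decay[OF fin sets less_imp_le[OF q(1)] base, of n] by blast
  have nD: "n \<ge> DIM('a)" using n by (simp add: m)
  let ?F = "\<lambda>y. of_real (odd_weight (snd y) ^ n) * cone_limit DIM('a) (snd y)"
  have intF: "integrable \<mu> ?F" by (rule cone_average_limit(2)[OF fin sets cone nD])
  have "of_real (exp_mass TYPE('a)) * (\<integral>y. ?F y \<partial>\<mu>) = 0"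
    by (rule LIMSEQ_unique[OF cone_average_limit(1)[OF fin sets cone nD] cone_average_decay[OF C' q(2)]])
  then have F0: "(\<integral>y. ?F y \<partial>\<mu>) = 0" using exp_mass_pos[where 'a='a] by simp
  have "(\<integral>y. Re (c * ?F y) \<partial>\<mu>) = Re (c * (\<integral>y. ?F y \<partial>\<mu>))"
    using intF by (simp only: integral_Re integrable_mult_right integral_mult_right_zero)
  then have R0: "(\<integral>y. Re (c * ?F y) \<partial>\<mu>) = 0" by (simp only: F0 mult_zero_right zero_complex.sel)
  have zero: "Re (c * ?F y) = 0" if "snd y = 0" for y
    using that n by (simp add: odd_weight_def power_0_left)
  have pos: "Re (c * ?F y) > 0" if "snd y \<noteq> 0" for y using sgn[OF that] by (simp add: m)
  have "integrable \<mu> (\<lambda>y. Re (c * ?F y))" by (intro integrable_Re integrable_mult_right intF)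
  moreover have "AE y in \<mu>. 0 \<le> Re (c * ?F y)"
    using zero pos by (metis (mono_tags, lifting) AE_I2 less_imp_le order_refl)
  ultimately have "AE y in \<mu>. Re (c * ?F y) = 0"
    using R0 integral_nonneg_eq_0_iff_AE by blast
  then have "AE y in \<mu>. y = 0"
    using cone
  proof eventually_elim
    case (elim y)
    then have "snd y = 0" using pos[of y] by (metis less_irrefl)
    with elim(2) show ?case by (simp add: prod_eq_iff)
  qed
  then have one: "fourier_measure \<mu> \<xi> = 1" for \<xi>
  proof -
    have "fourier_measure \<mu> \<xi> = (\<integral>y. 1 \<partial>\<mu>)"
      unfolding fourier_measure_def
    proof (rule integral_cong_AE)
      show "AE y in \<mu>. exp (- 2 * of_real pi * \<i> * of_real (\<xi> \<bullet> y)) = 1"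
        using \<open>AE y in \<mu>. y = 0\<close> by eventually_elim simp
    qed measurable
    then show ?thesis by (simp add: prob_space)
  qed
  have "((\<lambda>R. C * R powr (- q)) \<longlongrightarrow> C * 0) at_top"
    using q by (intro tendsto_mult tendsto_const tendsto_neg_powr filterlim_ident) auto
  then have "eventually (\<lambda>R. C * R powr (- q) < 1) at_top"
    by (rule order_tendstoD) simp
  then have "eventually (\<lambda>R. C * R powr (- q) < 1 \<and> R > 0) at_top"
    using eventually_gt_at_top by (rule eventually_conj)
  then obtain R where R: "C * R powr (- q) < 1" "R > 0" by (metis (mono_tags, lifting) eventually_at_top_linorder order_refl)
  have "norm (fourier_measure \<mu> (0, R)) \<le> C * norm ((0::'a), R) powr (- s / 2)"
    using R by (intro decay) (simp add: zero_prod_def)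
  with R show False by (simp add: one norm_Pair q_def)
qed

theorem theorem2p1:
  "fourier_dimension (light_cone :: ((real ^ 'd) \<times> real) set) = real CARD('d) - 1"
proof -
  let ?K = "light_cone :: ((real ^ 'd) \<times> real) set"
  have D: "DIM(real ^ 'd) = CARD('d)" by simp
  have "1 \<le> real CARD('d)" by (simp add: Suc_leI)
  then show ?thesis
    unfolding fourier_dimension_def
    using fourier_decay_cone[where 'a="real ^ 'd"] fourier_decay_cone_le[where 'a="real ^ 'd"]
    by (intro cSup_eq_maximum) (auto simp: light_cone_def D)
qed

end
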